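(* Let $M$ be a structure, $T=\mathrm{Th}(M)$, and let $G$ be a group definable over $M$. If $G$ is commutative and superstable, then $G$ has the J-property.
   Context: $G$ is called superstable if the theory induced on $G$ from $T$ is superstable (by the paper's convention, in this case one may simply assume that $T$ is superstable). Here $\mathbb{N}=\{1,2,\dots\}$. For $m\ge 1$ let $\mathfrak{j}_m=\{s\in\mathbb{N}^m : s(1)<s(2)<\dots<s(m)\}$. For a model $M$ over which $G$ is definable, $m\ge 1$, $a\in G(M)^{m+1}$, $t\in\mathfrak{j}_m$ and $f\in G(M)^{\mathbb{N}}$, put $\chi(m,a,t,f)=a(1)f(t(1))a(2)f(t(2))\cdots a(m)f(t(m))a(m+1)$. A subset $X\subset G(M)$ is a J-set of $G$ in $M$ if for every finite $F\subset G(M)^{\mathbb{N}}$ there are $m\ge 1$, $t\in\mathfrak{j}_m$ and $a\in G(M)^{m+1}$ such that $\chi(m,a,t,f)\in X$ for every $f\in F$. A subset $X\subset G(M)$ is generic if $G(M)$ is covered by finitely many left translates of $X$; $X$ is weakly generic if $X\cup Y$ is generic for some non-generic $Y\subset G(M)$. A definable group $G$ has the J-property if for some (equivalently, any) $\aleph_0$-saturated model $M$ (over which $G$ is definable; e.g. the monster model), the definable subsets of $G(M)$ that are J-sets of $G$ in $M$ coincide with those that are weakly generic in $G(M)$. *)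

theory Defs
  imports "HOL-Library.FuncSet" "HOL-Library.Equipollence" "HOL-Algebra.Coset"
begin

section \<open>First-order structures\<close>

text \<open>A symbol belongs to the language iff its arity is not \<open>None\<close>.  The types of symbols are
  arbitrary, so there is no bound on the size of a language.\<close>

record ('f, 'r) lang =
  fun_arity :: "'f \<Rightarrow> nat option"
  rel_arity :: "'r \<Rightarrow> nat option"

datatype 'f tm = Var nat | Fn 'f "'f tm list"

datatype ('f, 'r) fm =
    Eq "'f tm" "'f tm"
  | Rel 'r "'f tm list"
  | Neg "('f, 'r) fm"
  | And "('f, 'r) fm" "('f, 'r) fm"
  | Ex nat "('f, 'r) fm"

fun wf_tm :: "('f, 'r) lang \<Rightarrow> 'f tm \<Rightarrow> bool" where
  "wf_tm L (Var i) = True"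
| "wf_tm L (Fn f ts) = (fun_arity L f = Some (length ts) \<and> (\<forall>t\<in>set ts. wf_tm L t))"

fun wf_fm :: "('f, 'r) lang \<Rightarrow> ('f, 'r) fm \<Rightarrow> bool" where
  "wf_fm L (Eq s t) = (wf_tm L s \<and> wf_tm L t)"
| "wf_fm L (Rel r ts) = (rel_arity L r = Some (length ts) \<and> (\<forall>t\<in>set ts. wf_tm L t))"
| "wf_fm L (Neg \<phi>) = wf_fm L \<phi>"
| "wf_fm L (And \<phi> \<psi>) = (wf_fm L \<phi> \<and> wf_fm L \<psi>)"
| "wf_fm L (Ex i \<phi>) = wf_fm L \<phi>"

fun fv_tm :: "'f tm \<Rightarrow> nat set" where
  "fv_tm (Var i) = {i}"
| "fv_tm (Fn f ts) = (\<Union>t\<in>set ts. fv_tm t)"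

fun fv_fm :: "('f, 'r) fm \<Rightarrow> nat set" where
  "fv_fm (Eq s t) = fv_tm s \<union> fv_tm t"
| "fv_fm (Rel r ts) = (\<Union>t\<in>set ts. fv_tm t)"
| "fv_fm (Neg \<phi>) = fv_fm \<phi>"
| "fv_fm (And \<phi> \<psi>) = fv_fm \<phi> \<union> fv_fm \<psi>"
| "fv_fm (Ex i \<phi>) = fv_fm \<phi> - {i}"

record ('f, 'r, 'a) struct =
  dom :: "'a set"
  fun_int :: "'f \<Rightarrow> 'a list \<Rightarrow> 'a"
  rel_int :: "'r \<Rightarrow> 'a list \<Rightarrow> bool"

definition tuples :: "('f, 'r, 'a) struct \<Rightarrow> nat \<Rightarrow> 'a list set" where
  "tuples M n = {xs. length xs = n \<and> set xs \<subseteq> dom M}"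

definition is_structure :: "('f, 'r) lang \<Rightarrow> ('f, 'r, 'a) struct \<Rightarrow> bool" where
  "is_structure L M \<longleftrightarrow>
     dom M \<noteq> {} \<and>
     (\<forall>f n. fun_arity L f = Some n \<longrightarrow> (\<forall>xs\<in>tuples M n. fun_int M f xs \<in> dom M))"

fun eval_tm :: "('f, 'r, 'a) struct \<Rightarrow> (nat \<Rightarrow> 'a) \<Rightarrow> 'f tm \<Rightarrow> 'a" where
  "eval_tm M e (Var i) = e i"
| "eval_tm M e (Fn f ts) = fun_int M f (map (eval_tm M e) ts)"

fun sat :: "('f, 'r, 'a) struct \<Rightarrow> (nat \<Rightarrow> 'a) \<Rightarrow> ('f, 'r) fm \<Rightarrow> bool" where
  "sat M e (Eq s t) = (eval_tm M e s = eval_tm M e t)"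
| "sat M e (Rel r ts) = rel_int M r (map (eval_tm M e) ts)"
| "sat M e (Neg \<phi>) = (\<not> sat M e \<phi>)"
| "sat M e (And \<phi> \<psi>) = (sat M e \<phi> \<and> sat M e \<psi>)"
| "sat M e (Ex i \<phi>) = (\<exists>x\<in>dom M. sat M (e(i := x)) \<phi>)"

text \<open>\<open>holds M \<phi> zs\<close>: the variable \<open>i\<close> is interpreted by the \<open>i\<close>-th entry of \<open>zs\<close>.  It is only used
  when all free variables of \<open>\<phi>\<close> are less than \<open>length zs\<close>, so that the unspecified value of \<open>zs ! i\<close>
  beyond the end of the list plays no role.\<close>

definition holds :: "('f, 'r, 'a) struct \<Rightarrow> ('f, 'r) fm \<Rightarrow> 'a list \<Rightarrow> bool" where
  "holds M \<phi> zs \<longleftrightarrow> sat M ((!) zs) \<phi>"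


section \<open>Formulas with parameters, definable sets, types\<close>

text \<open>A formula \<open>\<phi>(x, b)\<close> in an \<open>n\<close>-tuple of variables \<open>x\<close> with parameters \<open>b\<close> from \<open>A\<close> is a pair
  \<open>(\<phi>, b)\<close>: the variables \<open>0, \<dots>, n - 1\<close> of \<open>\<phi>\<close> stand for \<open>x\<close>, the variables from \<open>n\<close> on for \<open>b\<close>.\<close>

definition forms :: "('f, 'r) lang \<Rightarrow> 'a set \<Rightarrow> nat \<Rightarrow> (('f, 'r) fm \<times> 'a list) set" where
  "forms L A n =
     {(\<phi>, b). wf_fm L \<phi> \<and> fv_fm \<phi> \<subseteq> {..<n + length b} \<and> set b \<subseteq> A}"

definition solutions :: "('f, 'r, 'a) struct \<Rightarrow> nat \<Rightarrow> ('f, 'r) fm \<times> 'a list \<Rightarrow> 'a list set" where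
  "solutions M n \<theta> = {xs \<in> tuples M n. holds M (fst \<theta>) (xs @ snd \<theta>)}"

definition definable :: "('f, 'r) lang \<Rightarrow> ('f, 'r, 'a) struct \<Rightarrow> nat \<Rightarrow> 'a list set \<Rightarrow> bool" where
  "definable L M n X \<longleftrightarrow> (\<exists>\<theta>\<in>forms L (dom M) n. X = solutions M n \<theta>)"

definition realizations ::
  "('f, 'r, 'a) struct \<Rightarrow> nat \<Rightarrow> (('f, 'r) fm \<times> 'a list) set \<Rightarrow> 'a list set" where
  "realizations M n p = {xs \<in> tuples M n. \<forall>\<theta>\<in>p. xs \<in> solutions M n \<theta>}"

definition tp ::
  "('f, 'r) lang \<Rightarrow> ('f, 'r, 'a) struct \<Rightarrow> 'a set \<Rightarrow> 'a list \<Rightarrow> (('f, 'r) fm \<times> 'a list) set" where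
  "tp L M A xs = {\<theta> \<in> forms L A (length xs). xs \<in> solutions M (length xs) \<theta>}"

definition realizes_types_over :: "('f, 'r) lang \<Rightarrow> ('f, 'r, 'a) struct \<Rightarrow> 'a set \<Rightarrow> bool" where
  "realizes_types_over L M A \<longleftrightarrow>
     (\<forall>n. \<forall>p\<subseteq>forms L A n.
        (\<forall>q\<subseteq>p. finite q \<longrightarrow> realizations M n q \<noteq> {}) \<longrightarrow> realizations M n p \<noteq> {})"

definition aleph0_saturated :: "('f, 'r) lang \<Rightarrow> ('f, 'r, 'a) struct \<Rightarrow> bool" where
  "aleph0_saturated L M \<longleftrightarrow> (\<forall>A\<subseteq>dom M. finite A \<longrightarrow> realizes_types_over L M A)"

text \<open>Small sets are those of cardinality at most \<open>\<kappa>\<close>, the number of all formulas, so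
  \<open>\<kappa> \<ge> \<aleph>\<^sub>0 + |L|\<close>; a monster model is one that is \<open>\<kappa>\<^sup>+\<close>-saturated.  Every theory has such a model
  (of cardinality at most \<open>2\<^sup>\<kappa>\<close>).\<close>

definition small :: "('f, 'r) lang \<Rightarrow> 'a set \<Rightarrow> bool" where
  "small L A \<longleftrightarrow> A \<lesssim> (UNIV :: ('f, 'r) fm set)"

definition monster :: "('f, 'r) lang \<Rightarrow> ('f, 'r, 'a) struct \<Rightarrow> bool" where
  "monster L M \<longleftrightarrow> (\<forall>A\<subseteq>dom M. small L A \<longrightarrow> realizes_types_over L M A)"

text \<open>\<open>(N, d)\<close> is a model of the complete theory of \<open>(M, c)\<close>.  In particular \<open>N\<close> is a model of
  \<open>Th(M)\<close>; an object defined over \<open>c\<close> in \<open>M\<close> is defined in \<open>N\<close> by the same formulas over \<open>d\<close>.  The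
  elementary extensions of \<open>M\<close> are the case \<open>d = c\<close>.\<close>

definition model_over ::
  "('f, 'r) lang \<Rightarrow> ('f, 'r, 'a) struct \<Rightarrow> 'a list \<Rightarrow> ('f, 'r, 'b) struct \<Rightarrow> 'b list \<Rightarrow> bool" where
  "model_over L M c N d \<longleftrightarrow>
     is_structure L N \<and> d \<in> tuples N (length c) \<and>
     (\<forall>\<phi>. wf_fm L \<phi> \<and> fv_fm \<phi> \<subseteq> {..<length c} \<longrightarrow> holds M \<phi> c = holds N \<phi> d)"


section \<open>Definable groups\<close>

text \<open>A group whose universe is a set of \<open>dim\<close>-tuples, defined by \<open>univ_fm(x, c)\<close>, and whose
  multiplication has the graph \<open>mult_fm(x, y, z, c)\<close>.\<close>

record ('f, 'r) dgroup =
  dim :: nat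
  univ_fm :: "('f, 'r) fm"
  mult_fm :: "('f, 'r) fm"

definition univ :: "('f, 'r, 'a) struct \<Rightarrow> ('f, 'r) dgroup \<Rightarrow> 'a list \<Rightarrow> 'a list set" where
  "univ M G c = solutions M (dim G) (univ_fm G, c)"

definition points :: "('f, 'r, 'a) struct \<Rightarrow> ('f, 'r) dgroup \<Rightarrow> 'a list \<Rightarrow> 'a list monoid" where
  "points M G c =
     (let m = (\<lambda>x y. THE z. z \<in> univ M G c \<and> holds M (mult_fm G) (x @ y @ z @ c))
      in \<lparr>carrier = univ M G c, mult = m,
          one = (THE u. u \<in> univ M G c \<and> (\<forall>x\<in>univ M G c. m u x = x \<and> m x u = x))\<rparr>)"

definition definable_group ::
  "('f, 'r) lang \<Rightarrow> ('f, 'r, 'a) struct \<Rightarrow> ('f, 'r) dgroup \<Rightarrow> 'a list \<Rightarrow> bool" where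
  "definable_group L M G c \<longleftrightarrow>
     (univ_fm G, c) \<in> forms L (dom M) (dim G) \<and>
     (mult_fm G, c) \<in> forms L (dom M) (3 * dim G) \<and>
     (\<forall>x\<in>univ M G c. \<forall>y\<in>univ M G c.
        \<exists>!z. z \<in> univ M G c \<and> holds M (mult_fm G) (x @ y @ z @ c)) \<and>
     group (points M G c)"


section \<open>Superstability\<close>

text \<open>In the next three definitions \<open>U\<close> is meant to be a monster model.\<close>

definition divides ::
  "('f, 'r) lang \<Rightarrow> ('f, 'r, 'a) struct \<Rightarrow> 'a set \<Rightarrow> nat \<Rightarrow> ('f, 'r) fm \<times> 'a list \<Rightarrow> bool" where
  "divides L U A n \<theta> \<longleftrightarrow>
     (\<exists>k (b :: nat \<Rightarrow> 'a list).
        (\<forall>i. b i \<in> tuples U (length (snd \<theta>)) \<and> tp L U A (b i) = tp L U A (snd \<theta>)) \<and>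
        (\<forall>I. finite I \<and> card I = k \<longrightarrow> (\<Inter>i\<in>I. solutions U n (fst \<theta>, b i)) = {}))"

text \<open>A type over a small set forks over \<open>A\<close> if it implies a finite disjunction of formulas that
  divide over \<open>A\<close>; by saturation, implication may be tested on realizations in \<open>U\<close>.\<close>

definition forks ::
  "('f, 'r) lang \<Rightarrow> ('f, 'r, 'a) struct \<Rightarrow> 'a set \<Rightarrow> nat \<Rightarrow> (('f, 'r) fm \<times> 'a list) set \<Rightarrow> bool" where
  "forks L U A n p \<longleftrightarrow>
     (\<exists>D\<subseteq>forms L (dom U) n. finite D \<and> (\<forall>\<theta>\<in>D. divides L U A n \<theta>) \<and>
        realizations U n p \<subseteq> (\<Union>\<theta>\<in>D. solutions U n \<theta>))"

definition order_property ::
  "('f, 'r, 'a) struct \<Rightarrow> 'a list set \<Rightarrow> nat \<Rightarrow> ('f, 'r) fm \<Rightarrow> bool" where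
  "order_property U S m \<phi> \<longleftrightarrow>
     (\<exists>(a :: nat \<Rightarrow> 'a list) (b :: nat \<Rightarrow> 'a list). (\<forall>i. a i \<in> S \<and> b i \<in> tuples U m) \<and>
        (\<forall>i j. holds U \<phi> (a i @ b j) \<longleftrightarrow> i < j))"

text \<open>\<open>G\<close> is superstable: \<open>G\<close> is stable, i.e. no formula \<open>\<phi>(x; y)\<close> with \<open>x\<close> ranging over \<open>G\<close> has the
  order property, and every complete type of an element of \<open>G\<close> does not fork over some finite subset
  of its domain.  (The constants \<open>c\<close> over which \<open>G\<close> is defined are treated as named.)  The structure
  induced on \<open>G\<close> is understood to include the relations on \<open>G\<close> that are definable with parameters
  outside \<open>G\<close>: \<open>y\<close> and the domains of types range over the whole monster model.  If
  \<open>Th(M)\<close> itself is superstable, then every group definable over \<open>M\<close> is superstable in this sense.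

  The type \<open>'u\<close> only serves to hold the monster model, and the property does not depend on the choice
  of the latter.  Provided that \<open>'u\<close> is large enough, e.g. the type of sets of formulas, a
  monster model exists in it.\<close>

definition superstable ::
  "'u itself \<Rightarrow> ('f, 'r) lang \<Rightarrow> ('f, 'r, 'a) struct \<Rightarrow> ('f, 'r) dgroup \<Rightarrow> 'a list \<Rightarrow> bool" where
  "superstable _ L M G c \<longleftrightarrow>
     (\<exists>(U :: ('f, 'r, 'u) struct) d. model_over L M c U d \<and> monster L U \<and>
        (\<forall>m \<phi>. wf_fm L \<phi> \<and> fv_fm \<phi> \<subseteq> {..<dim G + m} \<longrightarrow>
           \<not> order_property U (univ U G d) m \<phi>) \<and>
        (\<forall>A a. A \<subseteq> dom U \<and> small L A \<and> set d \<subseteq> A \<and> a \<in> univ U G d \<longrightarrow>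
           (\<exists>B\<subseteq>A. finite B \<and> \<not> forks L U B (dim G) (tp L U A a))))"


section \<open>J-sets, generic sets, and the J-property\<close>

definition jj :: "nat \<Rightarrow> nat list set" where
  "jj m = {s. length s = m \<and> set s \<subseteq> {1..} \<and> sorted_wrt (<) s}"

text \<open>For \<open>length t = m\<close> and \<open>length a = m + 1\<close> this is
  \<open>a(1) f(t(1)) a(2) f(t(2)) \<dots> a(m) f(t(m)) a(m+1)\<close>.\<close>

primrec chi :: "'g monoid \<Rightarrow> 'g list \<Rightarrow> nat list \<Rightarrow> (nat \<Rightarrow> 'g) \<Rightarrow> 'g" where
  "chi K a [] f = hd a"
| "chi K a (s # t) f = hd a \<otimes>\<^bsub>K\<^esub> f s \<otimes>\<^bsub>K\<^esub> chi K (tl a) t f"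

definition J_set :: "'g monoid \<Rightarrow> 'g set \<Rightarrow> bool" where
  "J_set K X \<longleftrightarrow> X \<subseteq> carrier K \<and>
     (\<forall>F. finite F \<and> F \<subseteq> ({1..} \<rightarrow>\<^sub>E carrier K) \<longrightarrow>
        (\<exists>m\<ge>1. \<exists>t\<in>jj m. \<exists>a. length a = m + 1 \<and> set a \<subseteq> carrier K \<and>
           (\<forall>f\<in>F. chi K a t f \<in> X)))"

definition generic :: "'g monoid \<Rightarrow> 'g set \<Rightarrow> bool" where
  "generic K X \<longleftrightarrow> X \<subseteq> carrier K \<and>
     (\<exists>A\<subseteq>carrier K. finite A \<and> carrier K = (\<Union>g\<in>A. g <#\<^bsub>K\<^esub> X))"

definition weakly_generic :: "'g monoid \<Rightarrow> 'g set \<Rightarrow> bool" where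
  "weakly_generic K X \<longleftrightarrow> X \<subseteq> carrier K \<and>
     (\<exists>Y\<subseteq>carrier K. \<not> generic K Y \<and> generic K (X \<union> Y))"

text \<open>Of the two equivalent forms of the definition (some / any \<open>\<aleph>\<^sub>0\<close>-saturated model) this is the
  one for any model, among those with universe contained in the type \<open>'b\<close>.\<close>

definition J_property ::
  "'b itself \<Rightarrow> ('f, 'r) lang \<Rightarrow> ('f, 'r, 'a) struct \<Rightarrow> ('f, 'r) dgroup \<Rightarrow> 'a list \<Rightarrow> bool" where
  "J_property _ L M G c \<longleftrightarrow>
     (\<forall>(N :: ('f, 'r, 'b) struct) d. model_over L M c N d \<and> aleph0_saturated L N \<longrightarrow>
        {X. X \<subseteq> univ N G d \<and> definable L N (dim G) X \<and> J_set (points N G d) X} =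
        {X. X \<subseteq> univ N G d \<and> definable L N (dim G) X \<and> weakly_generic (points N G d) X})"

end

theory Submission imports Defs "HOL-Algebra.FiniteProduct" begin

text \<open>
  Let \<open>N\<close> be a model in question and write \<open>P\<close> for the group of its points.  For definable \<open>X \<subseteq> P\<close> the proof
  goes around the circle: J-set \<open>\<Longrightarrow>\<close> generic \<open>\<Longrightarrow>\<close> weakly generic \<open>\<Longrightarrow>\<close> J-set.  As \<open>P\<close> is commutative, \<open>X\<close> is a
  J-set iff for finitely many sequences \<open>f\<close> there are always one \<open>a\<close> and one finite nonempty set \<open>t\<close> of
  indices with \<open>a \<cdot> f(t) \<in> X\<close> for all of them, where \<open>f(t) = \<Prod>s\<in>t. f s\<close> (\<open>J_set_iff\<close>).

  Generic sets are weakly generic because the empty set is not generic.  That weakly generic sets are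
  J-sets is pure combinatorics (\<open>weakly_generic_imp_J_set\<close>).  By a van der Waerden type theorem
  (\<open>IP_van_der_Waerden\<close>, proved by colour focusing), some finite set \<open>W \<subseteq> P\<close> contains, for every colouring
  with a given number of colours, a monochromatic configuration \<open>{a \<cdot> f(t) | f \<in> F}\<close>.  If \<open>X \<union> Y\<close> is
  generic and \<open>Y\<close> is not, then some translate of \<open>W\<close> is covered by finitely many fixed translates of \<open>X\<close>, and
  this covering is the colouring to be used.

  The implication from J-set to generic is where stability enters.  Let \<open>X\<close> be a J-set that is not
  generic.  As finitely many translates of \<open>X\<close> never cover \<open>P\<close>, one can always choose elements outside
  of them.  For a given \<open>n\<close> this allows one to construct sequences \<open>h\<^sub>0, \<dots>, h\<^sub>n\<^sub>-\<^sub>1\<close> such that, for each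
  nonempty \<open>t\<close> for which some \<open>a\<close> satisfies \<open>a \<cdot> h\<^sub>j(t) \<in> X\<close> for all \<open>j < n\<close>, there are \<open>a\<^sub>0, \<dots>, a\<^sub>n\<^sub>-\<^sub>1\<close> with
  \<open>a\<^sub>i \<cdot> h\<^sub>j(t) \<in> X \<longleftrightarrow> j \<le> i\<close>; the choice can be made for all \<open>t\<close> because only finitely many of them have a
  given maximum.  Since \<open>X\<close> is a J-set, such a \<open>t\<close> exists (\<open>nongeneric_J_set_chains\<close>).  Hence the
  definable relation \<open>x \<cdot> y \<in> X\<close> orders arbitrarily long finite sequences in \<open>N\<close>.  The existence of such
  sequences is a first-order statement, so they also exist in the monster model that witnesses the
  stability of the group (\<open>chain_transfer\<close>), where by saturation there is an infinite one
  (\<open>order_property_if_chains\<close>), a contradiction.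

  The statements about \<open>N\<close> and the monster model are obtained from the given model \<open>M\<close> by elementary
  equivalence.  For that purpose sentences about tuples are written as block formulas, which are
  translated into first-order formulas once and for all (\<open>sat_flatten\<close>, \<open>closed_block_fm_transfer\<close>); this
  also gives that \<open>P\<close> is a commutative group (\<open>comm_group_relation_transfer\<close>).
\<close>

section \<open>J-sets of a commutative group\<close>

text \<open>The notions \<^const>\<open>J_set\<close>, \<^const>\<open>generic\<close> and \<^const>\<open>weakly_generic\<close> are defined for monoid records
  without further fields, so the structure has to be fixed at that type.\<close>

locale plain_comm_group = comm_group G for G :: "'a monoid" (structure)
begin

text \<open>By commutativity the interleaved coefficients of \<^const>\<open>chi\<close> can be collected in one factor, which is
  the value of \<^const>\<open>chi\<close> on the constant sequence \<open>\<one>\<close>.\<close>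

lemma chi_eq:
  assumes "length a = Suc (length t)" "set a \<subseteq> carrier G" "f \<in> set t \<rightarrow> carrier G" "distinct t"
  shows "chi G a t (\<lambda>_. \<one>) \<in> carrier G \<and> chi G a t f = chi G a t (\<lambda>_. \<one>) \<otimes> finprod G f (set t)"
  using assms
proof (induction t arbitrary: a)
  case Nil
  then show ?case by (cases a) auto
next
  case (Cons s t)
  obtain x b where a: "a = x # b" using Cons.prems by (cases a) auto
  have IH: "chi G b t (\<lambda>_. \<one>) \<in> carrier G"
    "chi G b t f = chi G b t (\<lambda>_. \<one>) \<otimes> finprod G f (set t)"
    using Cons.IH[of b] Cons.prems a by auto
  have c: "x \<in> carrier G" "f s \<in> carrier G" "f \<in> set t \<rightarrow> carrier G" using Cons.prems a by auto
  have "finprod G f (set (s # t)) = f s \<otimes> finprod G f (set t)"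
    using Cons.prems c by simp
  then show ?case using c IH by (simp add: a m_ac)
qed

text \<open>Conversely every group element is the collected factor of some tuple of coefficients.\<close>

lemma chi_replicate:
  assumes "a \<in> carrier G"
  shows "chi G (a # replicate (length t) \<one>) t (\<lambda>_. \<one>) = a"
  using assms by (induction t arbitrary: a) auto

text \<open>The commutative form of the definition: the coefficients become one translation \<open>a\<close>, and the
  increasing tuple of indices becomes a finite nonempty set \<open>t\<close>.  Both have to work for all sequences
  in \<open>F\<close> at once.\<close>

lemma J_set_iff:
  "J_set G X \<longleftrightarrow> X \<subseteq> carrier G \<and>
     (\<forall>F. finite F \<and> F \<subseteq> ({1::nat..} \<rightarrow>\<^sub>E carrier G) \<longrightarrow>
        (\<exists>a\<in>carrier G. \<exists>t. finite t \<and> t \<noteq> {} \<and> t \<subseteq> {1..} \<and> (\<forall>f\<in>F. a \<otimes> finprod G f t \<in> X)))"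
proof -
  have "(\<exists>m\<ge>1. \<exists>t\<in>jj m. \<exists>a. length a = m + 1 \<and> set a \<subseteq> carrier G \<and> (\<forall>f\<in>F. chi G a t f \<in> X)) \<longleftrightarrow>
     (\<exists>a\<in>carrier G. \<exists>t. finite t \<and> t \<noteq> {} \<and> t \<subseteq> {1..} \<and> (\<forall>f\<in>F. a \<otimes> finprod G f t \<in> X))"
    (is "?L \<longleftrightarrow> ?R") if F: "F \<subseteq> ({1::nat..} \<rightarrow>\<^sub>E carrier G)" for F
  proof
    assume ?L
    then obtain m t a where *: "1 \<le> m" "t \<in> jj m" "length a = m + 1" "set a \<subseteq> carrier G"
      "\<forall>f\<in>F. chi G a t f \<in> X" by blast
    have t: "length t = m" "set t \<subseteq> {1..}" "distinct t"
      using * by (auto simp: jj_def strict_sorted_iff)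
    have fc: "f \<in> set t \<rightarrow> carrier G" if "f \<in> F" for f
      using F that t(2) by fastforce
    have c: "chi G a t (\<lambda>_. \<one>) \<in> carrier G"
      using chi_eq[of a t "\<lambda>_. \<one>"] * t by auto
    have "chi G a t (\<lambda>_. \<one>) \<otimes> finprod G f (set t) \<in> X" if f: "f \<in> F" for f
    proof -
      have "chi G a t f = chi G a t (\<lambda>_. \<one>) \<otimes> finprod G f (set t)"
        using chi_eq[of a t f] fc[OF f] * t by simp
      then show ?thesis using *(5) f by metis
    qed
    moreover have "set t \<noteq> {}" using * t by auto
    ultimately show ?R using c t(2) by (intro bexI[OF _ c] exI[of _ "set t"]) auto
  next
    assume ?R
    then obtain a t where *: "a \<in> carrier G" "finite t" "t \<noteq> {}" "t \<subseteq> {1..}"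
      "\<forall>f\<in>F. a \<otimes> finprod G f t \<in> X" by blast
    define u where "u = sorted_list_of_set t"
    have u: "set u = t" "distinct u" "sorted_wrt (<) u" "length u = card t"
      using * by (auto simp: u_def)
    have fc: "f \<in> set u \<rightarrow> carrier G" if "f \<in> F" for f
      using F that *(4) u(1) by fastforce
    have "chi G (a # replicate (card t) \<one>) u f \<in> X" if "f \<in> F" for f
    proof -
      have "chi G (a # replicate (card t) \<one>) u f = a \<otimes> finprod G f t"
        using chi_eq[of "a # replicate (card t) \<one>" u f] chi_replicate[of a u] fc[OF that] *(1) u by (auto simp: set_replicate_conv_if)
      then show ?thesis using *(5) that by simp
    qed
    then show ?L
      using * u by (intro exI[of _ "card t"] conjI bexI[of _ u] exI[of _ "a # replicate (card t) \<one>"])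
        (auto simp: jj_def card_gt_0_iff Suc_le_eq set_replicate_conv_if)
  qed
  note eq = this
  show ?thesis unfolding J_set_def
    by (simp only: eq cong: imp_cong conj_cong)
qed

section \<open>A van der Waerden theorem for finite products of sequences\<close>

definition monochromatic :: "(nat \<Rightarrow> 'a) set \<Rightarrow> ('a \<Rightarrow> nat) \<Rightarrow> nat set \<Rightarrow> 'a \<Rightarrow> nat \<Rightarrow> bool" where
  "monochromatic F \<chi> T a c \<longleftrightarrow>
     (\<exists>t. t \<noteq> {} \<and> t \<subseteq> T \<and> (\<forall>f\<in>F. \<chi> (a \<otimes> finprod G f t) = c))"

text \<open>The quantifier over \<open>M\<close> allows one to look for \<open>t\<close> beyond any given bound, and \<open>N\<close> and \<open>S\<close>, which do
  not depend on the colouring, confine the configuration to finitely many points.  Both are needed for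
  the colour focusing below: the second makes the colourings of a whole neighbourhood of a point a
  colouring with finitely many colours.\<close>

definition vdw_family :: "(nat \<Rightarrow> 'a) set \<Rightarrow> bool" where
  "vdw_family F \<longleftrightarrow> (\<forall>r M. \<exists>N S. finite S \<and> S \<subseteq> carrier G \<and>
     (\<forall>\<chi>\<in>carrier G \<rightarrow> {..<r::nat}. \<exists>a\<in>S. \<exists>c. monochromatic F \<chi> {M<..N} a c))"

lemma vdw_familyD:
  assumes "vdw_family F"
  shows "\<exists>N S. finite S \<and> S \<subseteq> carrier G \<and>
     (\<forall>\<chi>\<in>carrier G \<rightarrow> {..<r::nat}. \<exists>a\<in>S. \<exists>c. monochromatic F \<chi> {M<..N} a c)"
  using assms unfolding vdw_family_def by simp

lemma vdw_familyI:
  assumes "\<And>r M. \<exists>N S. finite S \<and> S \<subseteq> carrier G \<and>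
     (\<forall>\<chi>\<in>carrier G \<rightarrow> {..<r::nat}. \<exists>a\<in>S. \<exists>c. monochromatic F \<chi> {M<..N} a c)"
  shows "vdw_family F"
  using assms unfolding vdw_family_def by simp

text \<open>Multiplying all sequences by the same sequence \<open>g\<close> multiplies the points of a configuration by the
  common factor \<open>\<Prod>s\<in>t. g s\<close>, which can be compensated in \<open>a\<close>.\<close>

lemma vdw_translate:
  assumes F: "F \<subseteq> UNIV \<rightarrow> carrier G" and g: "g \<in> UNIV \<rightarrow> carrier G" and vdw: "vdw_family F"
  shows "vdw_family ((\<lambda>f s. f s \<otimes> g s) ` F)"
proof (rule vdw_familyI)
  fix r M
  from vdw_familyD[OF vdw, of r M] obtain N S where NS: "finite S" "S \<subseteq> carrier G" and
    V: "\<forall>\<chi>\<in>carrier G \<rightarrow> {..<r}. \<exists>a\<in>S. \<exists>c. monochromatic F \<chi> {M<..N} a c"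
    by (elim exE conjE)
  have gt: "finprod G g t \<in> carrier G" for t using g by (auto intro: finprod_closed)
  have ft: "finprod G f t \<in> carrier G" if "f \<in> F" for f t using F that by (auto intro!: finprod_closed)
  let ?S = "(\<lambda>(a, t). a \<otimes> inv (finprod G g t)) ` (S \<times> Pow {M<..N})"
  have "\<exists>a\<in>?S. \<exists>c. monochromatic ((\<lambda>f s. f s \<otimes> g s) ` F) \<chi> {M<..N} a c"
    if \<chi>: "\<chi> \<in> carrier G \<rightarrow> {..<r}" for \<chi>
  proof -
    from bspec[OF V \<chi>] obtain a t c where *: "a \<in> S" "t \<noteq> {}" "t \<subseteq> {M<..N}"
      "\<forall>f\<in>F. \<chi> (a \<otimes> finprod G f t) = c" unfolding monochromatic_def by blast
    have "(a \<otimes> inv (finprod G g t)) \<otimes> finprod G (\<lambda>s. f s \<otimes> g s) t = a \<otimes> finprod G f t"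
      if f: "f \<in> F" for f
    proof -
      have "finprod G (\<lambda>s. f s \<otimes> g s) t = finprod G g t \<otimes> finprod G f t"
        using F g f gt[of t] ft[OF f, of t] by (subst finprod_multf) (auto simp: m_comm)
      moreover have "a \<in> carrier G" using * NS by auto
      ultimately show ?thesis using gt[of t] ft[OF f, of t]
        by (simp add: m_assoc inv_solve_left')
    qed
    then have "monochromatic ((\<lambda>f s. f s \<otimes> g s) ` F) \<chi> {M<..N} (a \<otimes> inv (finprod G g t)) c"
      using * unfolding monochromatic_def by (intro exI[of _ t]) auto
    moreover have "a \<otimes> inv (finprod G g t) \<in> ?S" using * by force
    ultimately show ?thesis by blast
  qed
  moreover have "finite ?S" "?S \<subseteq> carrier G" using NS gt by auto
  ultimately show "\<exists>N S. finite S \<and> S \<subseteq> carrier G \<and>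
     (\<forall>\<chi>\<in>carrier G \<rightarrow> {..<r}. \<exists>a\<in>S. \<exists>c. monochromatic ((\<lambda>f s. f s \<otimes> g s) ` F) \<chi> {M<..N} a c)"
    by (intro exI[of _ N] exI[of _ ?S]) blast
qed

text \<open>The state of the colour focusing argument at the focus \<open>b\<close>: either \<open>b\<close> and its configuration have one
  colour, or \<open>b\<close> is the focus of monochromatic configurations in \<open>s\<close> colours, all of them different from
  the colour of \<open>b\<close>.\<close>

definition focused :: "(nat \<Rightarrow> 'a) set \<Rightarrow> ('a \<Rightarrow> nat) \<Rightarrow> nat set \<Rightarrow> nat \<Rightarrow> nat \<Rightarrow> 'a \<Rightarrow> bool" where
  "focused F \<chi> T r s b \<longleftrightarrow> monochromatic F \<chi> T b (\<chi> b) \<or>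
     (\<exists>C\<subseteq>{..<r}. card C = s \<and> \<chi> b \<notin> C \<and> (\<forall>c\<in>C. monochromatic F \<chi> T b c))"

text \<open>Passing from \<open>s\<close> to \<open>s + 1\<close> colours: the points of the induction hypothesis lie in a finite set \<open>W\<close>.
  Colour \<open>x\<close> by the whole colouring of \<open>x \<cdot> W\<close>, which is a colouring with finitely many colours, and
  find \<open>x\<close> and \<open>t'\<close> beyond \<open>N\<close> such that all the translates of \<open>W\<close> by \<open>x \<cdot> f(t')\<close>, \<open>f \<in> F\<close>, are coloured
  alike; let \<open>y\<close> be one of these \<open>x \<cdot> f(t')\<close>.  The hypothesis for this common colouring gives a focus \<open>b\<close>.
  Then \<open>x \<cdot> b\<close> is a focus for the old colours, with \<open>t' \<union> t\<close> in place of \<open>t\<close>, and in addition for the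
  colour of \<open>y \<cdot> b\<close>, with \<open>t'\<close> itself.  If the first alternative holds for the common colouring, the
  focus \<open>y \<cdot> b\<close> inherits it.\<close>

lemma colour_focusing:
  assumes fin: "finite F" and F: "F \<subseteq> UNIV \<rightarrow> carrier G" and vdw: "vdw_family F"
  shows "\<exists>N S. finite S \<and> S \<subseteq> carrier G \<and>
     (\<forall>\<chi>\<in>carrier G \<rightarrow> {..<r::nat}. \<exists>b\<in>S. focused F \<chi> {M<..N} r s b)"
proof (induction s)
  case 0
  have "focused F \<chi> {M<..M} r 0 \<one>" for \<chi>
    unfolding focused_def by (intro disjI2 exI[of _ "{}"]) auto
  then show ?case by (intro exI[of _ M] exI[of _ "{\<one>}"]) auto
next
  case (Suc s)
  then obtain N S where NS: "finite S" "S \<subseteq> carrier G" and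
    IH: "\<forall>\<chi>\<in>carrier G \<rightarrow> {..<r}. \<exists>b\<in>S. focused F \<chi> {M<..N} r s b"
    by (elim exE conjE)
  have ft: "finprod G f t \<in> carrier G" if "f \<in> F" for f t using F that by (auto intro!: finprod_closed)
  define W where "W = S \<union> (\<lambda>(b, f, t). b \<otimes> finprod G f t) ` (S \<times> F \<times> Pow {M<..N})"
  have W: "finite W" "W \<subseteq> carrier G" unfolding W_def using NS fin ft by auto
  have WS: "S \<subseteq> W" by (auto simp: W_def)
  have WF: "b \<otimes> finprod G f t \<in> W" if "b \<in> S" "f \<in> F" "t \<subseteq> {M<..N}" for b f t
    using that unfolding W_def by force
  have "finite (W \<rightarrow>\<^sub>E {..<r})" using W by (intro finite_PiE) auto
  \<comment> \<open>Colours are natural numbers, so the colourings of \<open>W\<close> have to be coded by numbers below some \<open>q\<close>.\<close>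
  from finite_imp_inj_to_nat_seg[OF this] obtain enc :: "('a \<Rightarrow> nat) \<Rightarrow> nat" and q where
    enc: "enc ` (W \<rightarrow>\<^sub>E {..<r}) = {i. i < q}" "inj_on enc (W \<rightarrow>\<^sub>E {..<r})"
    by (elim exE conjE)
  from vdw_familyD[OF vdw, of q "max M N"] obtain N' S' where NS': "finite S'" "S' \<subseteq> carrier G" and
    V: "\<forall>\<chi>\<in>carrier G \<rightarrow> {..<q}. \<exists>a\<in>S'. \<exists>c. monochromatic F \<chi> {max M N<..N'} a c"
    by (elim exE conjE)
  define S1 where "S1 = S' \<union> (\<lambda>(x, f, t). x \<otimes> finprod G f t) ` (S' \<times> F \<times> Pow {max M N<..N'})"
  have S1: "finite S1" "S1 \<subseteq> carrier G" unfolding S1_def using NS' fin ft by auto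
  define S2 where "S2 = (\<lambda>(x, b). x \<otimes> b) ` (S1 \<times> S)"
  have S2: "finite S2" "S2 \<subseteq> carrier G" unfolding S2_def using NS S1 by auto
  let ?N = "max N N'"
  have "\<exists>b\<in>S2. focused F \<chi> {M<..?N} r (Suc s) b" if \<chi>: "\<chi> \<in> carrier G \<rightarrow> {..<r}" for \<chi>
  proof -
    define \<chi>' where "\<chi>' x = enc (\<lambda>w\<in>W. \<chi> (x \<otimes> w))" for x
    have rin: "(\<lambda>w\<in>W. \<chi> (x \<otimes> w)) \<in> W \<rightarrow>\<^sub>E {..<r}" if "x \<in> carrier G" for x
      using \<chi> that W by (auto intro!: restrict_PiE_iff[THEN iffD2])
    have "\<chi>' \<in> carrier G \<rightarrow> {..<q}" 
    proof (rule Pi_I)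
      fix x assume "x \<in> carrier G"
      from imageI[OF rin[OF this], of enc] show "\<chi>' x \<in> {..<q}" by (simp add: enc(1) \<chi>'_def)
    qed
    from bspec[OF V this] obtain x t' c' where x: "x \<in> S'" and t': "t' \<noteq> {}" "t' \<subseteq> {max M N<..N'}"
      and c': "\<forall>f\<in>F. \<chi>' (x \<otimes> finprod G f t') = c'" unfolding monochromatic_def by blast
    have xc: "x \<in> carrier G" using x NS' by auto
    have t'b: "t' \<subseteq> {M<..?N}" using t'(2) by (auto simp: subset_iff)
    \<comment> \<open>If \<open>F\<close> is empty there is no \<open>x \<cdot> f(t')\<close>, and any point can serve as \<open>y\<close>.\<close>
    obtain y where y: "y \<in> S1" and same: "\<forall>f\<in>F. \<forall>w\<in>W. \<chi> (x \<otimes> finprod G f t' \<otimes> w) = \<chi> (y \<otimes> w)"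
    proof (cases "F = {}")
      case True
      then show ?thesis using that[of x] x S1_def by auto
    next
      case False
      then obtain f1 where f1: "f1 \<in> F" by auto
      have "x \<otimes> finprod G f1 t' \<in> S1" unfolding S1_def using x f1 t' by force
      moreover have "\<forall>f\<in>F. \<forall>w\<in>W. \<chi> (x \<otimes> finprod G f t' \<otimes> w) = \<chi> (x \<otimes> finprod G f1 t' \<otimes> w)"
      proof (intro ballI)
        fix f w assume fw: "f \<in> F" "w \<in> W"
        have "enc (\<lambda>w\<in>W. \<chi> (x \<otimes> finprod G f t' \<otimes> w)) = enc (\<lambda>w\<in>W. \<chi> (x \<otimes> finprod G f1 t' \<otimes> w))"
          using c' f1 fw unfolding \<chi>'_def by metis
        then have "(\<lambda>w\<in>W. \<chi> (x \<otimes> finprod G f t' \<otimes> w)) = (\<lambda>w\<in>W. \<chi> (x \<otimes> finprod G f1 t' \<otimes> w))"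
          using f1 fw xc ft by (intro inj_onD[OF enc(2)] rin) auto
        from fun_cong[OF this, of w] show "\<chi> (x \<otimes> finprod G f t' \<otimes> w) = \<chi> (x \<otimes> finprod G f1 t' \<otimes> w)"
          using fw by simp
      qed
      ultimately show ?thesis using that by blast
    qed
    have yc: "y \<in> carrier G" using y S1 by auto
    have "(\<lambda>w. \<chi> (y \<otimes> w)) \<in> carrier G \<rightarrow> {..<r}" using \<chi> yc by auto
    with IH obtain b where b: "b \<in> S" and alt: "focused F (\<lambda>w. \<chi> (y \<otimes> w)) {M<..N} r s b" by blast
    have bc: "b \<in> carrier G" using b NS by auto
    have yb: "y \<otimes> b \<in> S2" using y b unfolding S2_def by force
    have xb: "x \<otimes> b \<in> S2" using x b unfolding S2_def S1_def by force
    have new: "monochromatic F \<chi> {M<..?N} (x \<otimes> b) (\<chi> (y \<otimes> b))"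
    proof -
      have "\<chi> (x \<otimes> b \<otimes> finprod G f t') = \<chi> (y \<otimes> b)" if f: "f \<in> F" for f
      proof -
        have "x \<otimes> b \<otimes> finprod G f t' = x \<otimes> finprod G f t' \<otimes> b" using xc bc ft[OF f] by (simp add: m_ac)
        then show ?thesis using same f b WS by auto
      qed
      then show ?thesis using t'(1) t'b unfolding monochromatic_def by (intro exI[of _ t']) simp
    qed
    have old: "monochromatic F \<chi> {M<..?N} (x \<otimes> b) c"
      if "monochromatic F (\<lambda>w. \<chi> (y \<otimes> w)) {M<..N} b c" for c
    proof -
      from that obtain t where t: "t \<noteq> {}" "t \<subseteq> {M<..N}" "\<forall>f\<in>F. \<chi> (y \<otimes> (b \<otimes> finprod G f t)) = c"
        unfolding monochromatic_def by blast
      have "\<chi> (x \<otimes> b \<otimes> finprod G f (t' \<union> t)) = c" if f: "f \<in> F" for f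
      proof -
        \<comment> \<open>This is where \<open>t'\<close> has to lie beyond \<open>N\<close>.\<close>
        have disj: "t' \<inter> t = {}" using t(2) t'(2) by fastforce
        have "finprod G f (t' \<union> t) = finprod G f t' \<otimes> finprod G f t"
          using disj f F t t' by (intro finprod_Un_disjoint) (auto intro: finite_subset)
        then have "x \<otimes> b \<otimes> finprod G f (t' \<union> t) = x \<otimes> finprod G f t' \<otimes> (b \<otimes> finprod G f t)"
          using xc bc ft[OF f] by (simp add: m_ac)
        then show ?thesis using same f WF[OF b f t(2)] t(3) by auto
      qed
      moreover have "t' \<union> t \<subseteq> {M<..?N}" using t(2) t'b by (auto simp: subset_iff)
      ultimately show ?thesis using t(1) unfolding monochromatic_def by (intro exI[of _ "t' \<union> t"]) simp
    qed
    from alt consider "monochromatic F (\<lambda>w. \<chi> (y \<otimes> w)) {M<..N} b (\<chi> (y \<otimes> b))"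
      | C where "C \<subseteq> {..<r}" "card C = s" "\<chi> (y \<otimes> b) \<notin> C"
          "\<forall>c\<in>C. monochromatic F (\<lambda>w. \<chi> (y \<otimes> w)) {M<..N} b c"
      unfolding focused_def by blast
    then show ?thesis
    proof cases
      case 1
      then obtain t where t: "t \<noteq> {}" "t \<subseteq> {M<..N}"
        "\<forall>f\<in>F. \<chi> (y \<otimes> (b \<otimes> finprod G f t)) = \<chi> (y \<otimes> b)" unfolding monochromatic_def by blast
      have "y \<otimes> b \<otimes> finprod G f t = y \<otimes> (b \<otimes> finprod G f t)" if "f \<in> F" for f
        using yc bc ft[OF that] by (simp add: m_assoc)
      moreover have "t \<subseteq> {M<..?N}" using t(2) by (auto simp: subset_iff)
      ultimately have "monochromatic F \<chi> {M<..?N} (y \<otimes> b) (\<chi> (y \<otimes> b))"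
        using t unfolding monochromatic_def by (intro exI[of _ t]) auto
      then show ?thesis using yb unfolding focused_def by blast
    next
      case (2 C)
      let ?C = "insert (\<chi> (y \<otimes> b)) C"
      have CC: "\<forall>c\<in>?C. monochromatic F \<chi> {M<..?N} (x \<otimes> b) c" using new old 2(4) by blast
      have "focused F \<chi> {M<..?N} r (Suc s) (x \<otimes> b)"
      proof (cases "\<chi> (x \<otimes> b) \<in> ?C")
        case True
        with CC show ?thesis unfolding focused_def by blast
      next
        case False
        have "finite C" using 2(1) finite_subset by blast
        moreover have "\<chi> (y \<otimes> b) < r" using \<chi> yc bc by auto
        ultimately have "?C \<subseteq> {..<r}" "card ?C = Suc s" using 2 by auto
        with False CC show ?thesis unfolding focused_def by blast
      qed
      then show ?thesis using xb by blast
    qed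
  qed
  with S2 show ?case by (intro exI[of _ ?N] exI[of _ S2]) blast
qed

text \<open>Focusing in \<open>r\<close> colours leaves no colour for the focus, so the first alternative must hold.
  Its focus \<open>b\<close> is the point belonging to the constant sequence \<open>\<one>\<close>.\<close>

lemma vdw_insert_one:
  assumes fin: "finite F" and F: "F \<subseteq> UNIV \<rightarrow> carrier G" and vdw: "vdw_family F"
  shows "vdw_family (insert (\<lambda>_. \<one>) F)"
proof (rule vdw_familyI)
  fix r M :: nat
  from colour_focusing[OF assms, of r M r] obtain N S where NS: "finite S" "S \<subseteq> carrier G" and
    H: "\<forall>\<chi>\<in>carrier G \<rightarrow> {..<r}. \<exists>b\<in>S. focused F \<chi> {M<..N} r r b" by (elim exE conjE)
  have "\<exists>a\<in>S. \<exists>c. monochromatic (insert (\<lambda>_. \<one>) F) \<chi> {M<..N} a c"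
    if \<chi>: "\<chi> \<in> carrier G \<rightarrow> {..<r}" for \<chi>
  proof -
    from H \<chi> obtain b where b: "b \<in> S" and alt: "focused F \<chi> {M<..N} r r b" by blast
    have bc: "b \<in> carrier G" using b NS by auto
    have "\<not> (\<exists>C\<subseteq>{..<r}. card C = r \<and> \<chi> b \<notin> C)"
    proof
      assume "\<exists>C\<subseteq>{..<r}. card C = r \<and> \<chi> b \<notin> C"
      then obtain C where "C \<subseteq> {..<r}" "card C = r" "\<chi> b \<notin> C" by blast
      then have "C = {..<r}" by (intro card_subset_eq) auto
      then show False using \<open>\<chi> b \<notin> C\<close> \<chi> bc by auto
    qed
    with alt have "monochromatic F \<chi> {M<..N} b (\<chi> b)" unfolding focused_def by blast
    then have "monochromatic (insert (\<lambda>_. \<one>) F) \<chi> {M<..N} b (\<chi> b)"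
      using bc unfolding monochromatic_def by auto
    then show ?thesis using b by blast
  qed
  then show "\<exists>N S. finite S \<and> S \<subseteq> carrier G \<and> (\<forall>\<chi>\<in>carrier G \<rightarrow> {..<r}.
       \<exists>a\<in>S. \<exists>c. monochromatic (insert (\<lambda>_. \<one>) F) \<chi> {M<..N} a c)"
    using NS by (intro exI[of _ N] exI[of _ S] conjI ballI)
qed

text \<open>To add a sequence \<open>g\<close> to \<open>F\<close>, divide everything by \<open>g\<close>, add the constant sequence \<open>\<one>\<close>, and multiply
  by \<open>g\<close> again.\<close>

lemma IP_van_der_Waerden:
  assumes "finite F" "F \<subseteq> UNIV \<rightarrow> carrier G"
  shows "vdw_family F"
  using assms
proof (induction F rule: finite_induct)
  case empty
  show ?case
  proof (rule vdw_familyI)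
    fix r M :: nat
    have "monochromatic {} \<chi> {M<..Suc M} \<one> c" for \<chi> c
      unfolding monochromatic_def by (intro exI[of _ "{Suc M}"]) auto
    then show "\<exists>N S. finite S \<and> S \<subseteq> carrier G \<and>
       (\<forall>\<chi>\<in>carrier G \<rightarrow> {..<r}. \<exists>a\<in>S. \<exists>c. monochromatic {} \<chi> {M<..N} a c)"
      by (intro exI[of _ "Suc M"] exI[of _ "{\<one>}"]) simp
  qed
next
  case (insert g F)
  let ?h = "\<lambda>s. inv (g s)"
  let ?F = "(\<lambda>f s. f s \<otimes> ?h s) ` F"
  have g: "g \<in> UNIV \<rightarrow> carrier G" "?h \<in> UNIV \<rightarrow> carrier G" and F: "F \<subseteq> UNIV \<rightarrow> carrier G"
    using insert.prems by auto
  have F': "?F \<subseteq> UNIV \<rightarrow> carrier G" using F g by (auto simp: Pi_iff subset_iff)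
  have "vdw_family (insert (\<lambda>_. \<one>) ?F)"
    using insert.hyps F' vdw_translate[OF F g(2)] insert.IH[OF F] by (intro vdw_insert_one) auto
  then have "vdw_family ((\<lambda>f s. f s \<otimes> g s) ` insert (\<lambda>_. \<one>) ?F)"
    using F' g by (intro vdw_translate) auto
  moreover have "(\<lambda>f s. f s \<otimes> g s) ` insert (\<lambda>_. \<one>) ?F = insert g F"
  proof -
    have "(\<lambda>s. f s \<otimes> ?h s \<otimes> g s) = f" if "f \<in> F" for f
      using F g that by (auto simp: Pi_iff subset_iff m_assoc)
    then have "(\<lambda>f s. f s \<otimes> g s) ` ?F = F" by (force simp: image_image)
    moreover have "(\<lambda>s. \<one> \<otimes> g s) = g" using g by (auto simp: Pi_iff)
    ultimately show ?thesis by simp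
  qed
  ultimately show ?case by simp
qed

section \<open>Weakly generic sets are J-sets\<close>

lemma non_generic_avoids_translates:
  assumes "\<not> generic G Y" "Y \<subseteq> carrier G" "finite W" "W \<subseteq> carrier G"
  shows "\<exists>g\<in>carrier G. \<forall>w\<in>W. w \<otimes> g \<notin> Y"
proof (rule ccontr)
  assume *: "\<not> ?thesis"
  have "carrier G = (\<Union>g\<in>m_inv G ` W. g <#\<^bsub>G\<^esub> Y)"
  proof (intro equalityI subsetI)
    fix g assume g: "g \<in> carrier G"
    then obtain w where w: "w \<in> W" "w \<otimes> g \<in> Y" using * by blast
    have "g = inv w \<otimes> (w \<otimes> g)" using g w assms by (auto simp: m_assoc[symmetric])
    then show "g \<in> (\<Union>g\<in>m_inv G ` W. g <#\<^bsub>G\<^esub> Y)" using w by (auto simp: l_coset_def)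
  qed (use assms in \<open>auto simp: l_coset_def\<close>)
  moreover have "m_inv G ` W \<subseteq> carrier G" "finite (m_inv G ` W)" using assms by auto
  ultimately show False using assms(1,2) unfolding generic_def by blast
qed

lemma generic_imp_weakly_generic:
  assumes "generic G X"
  shows "weakly_generic G X"
proof -
  have "\<not> generic G {}" by (auto simp: generic_def l_coset_def)
  then show ?thesis 
    using assms unfolding weakly_generic_def
    by (intro conjI exI[of _ "{}"]) (auto simp: generic_def)
qed

text \<open>Let finitely many translates \<open>h \<cdot> (X \<union> Y)\<close>, \<open>h \<in> A\<close>, cover the group.  As \<open>Y\<close> is not generic, any finite
  set \<open>W\<close> has a translate \<open>W \<cdot> g\<close> that avoids the translates \<open>h \<cdot> Y\<close>, and is therefore covered by the
  translates \<open>h \<cdot> X\<close> alone.  Take for \<open>W\<close> the finite set in which every colouring with \<open>|A|\<close> colours has a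
  monochromatic configuration, and colour its elements \<open>w\<close> by an \<open>h\<close> with \<open>w \<cdot> g \<in> h \<cdot> X\<close>.\<close>

lemma weakly_generic_imp_J_set:
  assumes "weakly_generic G X"
  shows "J_set G X"
  unfolding J_set_iff
proof (intro conjI allI impI)
  from assms obtain Y where X: "X \<subseteq> carrier G" and Y: "Y \<subseteq> carrier G" "\<not> generic G Y"
    and XY: "generic G (X \<union> Y)" unfolding weakly_generic_def by blast
  then show "X \<subseteq> carrier G" by simp
  from XY obtain A where A: "A \<subseteq> carrier G" "finite A" "carrier G = (\<Union>g\<in>A. g <#\<^bsub>G\<^esub> (X \<union> Y))"
    unfolding generic_def by blast
  fix F assume "finite F \<and> F \<subseteq> ({1::nat..} \<rightarrow>\<^sub>E carrier G)"
  then have F: "finite F" "F \<subseteq> ({1..} \<rightarrow>\<^sub>E carrier G)" by auto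
  \<comment> \<open>The sequences of a J-set are indexed by the positive integers and undefined at \<open>0\<close>.\<close>
  define ext :: "(nat \<Rightarrow> 'a) \<Rightarrow> nat \<Rightarrow> 'a" where "ext f s = (if 1 \<le> s then f s else \<one>)" for f s
  have extF: "ext f \<in> UNIV \<rightarrow> carrier G" if "f \<in> F" for f
  proof -
    have "f \<in> {1..} \<rightarrow>\<^sub>E carrier G" using that F(2) by (rule rev_subsetD)
    then show ?thesis by (auto simp: ext_def PiE_iff)
  qed
  have ext_eq: "finprod G (ext f) t = finprod G f t" if "f \<in> F" "t \<subseteq> {1..}" for f t
  proof (rule finprod_cong'[OF refl])
    have "f \<in> {1..} \<rightarrow>\<^sub>E carrier G" using that(1) F(2) by (rule rev_subsetD)
    then show "f \<in> t \<rightarrow> carrier G" using that(2) by (auto simp: PiE_iff)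
    show "ext f s = f s" if "s \<in> t" for s using that \<open>t \<subseteq> {1..}\<close> by (auto simp: ext_def)
  qed
  from finite_imp_inj_to_nat_seg[OF A(2)] obtain idx :: "'a \<Rightarrow> nat" and r
    where idx: "idx ` A = {i. i < r}" "inj_on idx A" by (elim exE conjE)
  have "vdw_family (ext ` F)" using F extF by (intro IP_van_der_Waerden) auto
  from vdw_familyD[OF this, of r 0] obtain N S where S: "finite S" "S \<subseteq> carrier G" and
    V: "\<forall>\<chi>\<in>carrier G \<rightarrow> {..<r}. \<exists>a\<in>S. \<exists>c. monochromatic (ext ` F) \<chi> {0<..N} a c"
    by (elim exE conjE)
  have ft: "finprod G (ext f) t \<in> carrier G" if "f \<in> F" for f t
    using extF[OF that] by (auto intro!: finprod_closed)
  define W where "W = (\<lambda>(a, f, t). a \<otimes> finprod G (ext f) t) ` (S \<times> F \<times> Pow {0<..N})"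
  have W: "finite W" "W \<subseteq> carrier G" unfolding W_def using S F ft by auto
  let ?W' = "(\<lambda>(h, w). inv h \<otimes> w) ` (A \<times> W)"
  have "finite ?W'" "?W' \<subseteq> carrier G" using A(1,2) W by auto
  from non_generic_avoids_translates[OF Y(2,1) this]
  obtain g where g: "g \<in> carrier G" "\<forall>w\<in>?W'. w \<otimes> g \<notin> Y" by blast
  have ex: "\<exists>h\<in>A. w \<in> W \<longrightarrow> inv h \<otimes> w \<otimes> g \<in> X" if w: "w \<in> carrier G" for w
  proof -
    have "w \<otimes> g \<in> (\<Union>g\<in>A. g <#\<^bsub>G\<^esub> (X \<union> Y))" using m_closed[OF w g(1)] A(3) by metis
    then obtain h z where h: "h \<in> A" "z \<in> X \<union> Y" "w \<otimes> g = h \<otimes> z" by (auto simp: l_coset_def)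
    have c: "h \<in> carrier G" "z \<in> carrier G" using h A X Y by auto
    have "inv h \<otimes> w \<otimes> g = z" using h c w g by (simp add: m_assoc) (simp add: m_assoc[symmetric])
    moreover have "inv h \<otimes> w \<in> ?W'" if "w \<in> W" using h that by force
    ultimately show ?thesis using h g by blast
  qed
  define col where "col w = (SOME h. h \<in> A \<and> (w \<in> W \<longrightarrow> inv h \<otimes> w \<otimes> g \<in> X))" for w
  have col: "col w \<in> A" "w \<in> W \<Longrightarrow> inv (col w) \<otimes> w \<otimes> g \<in> X" if "w \<in> carrier G" for w
    using someI_ex[of "\<lambda>h. h \<in> A \<and> (w \<in> W \<longrightarrow> inv h \<otimes> w \<otimes> g \<in> X)"] ex[OF that]
    unfolding col_def by auto
  have "(\<lambda>w. idx (col w)) \<in> carrier G \<rightarrow> {..<r}" 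
  proof (rule Pi_I)
    fix w assume "w \<in> carrier G"
    from imageI[OF col(1)[OF this], of idx] show "idx (col w) \<in> {..<r}" by (simp add: idx(1))
  qed
  from bspec[OF V this] obtain a t c where a: "a \<in> S" and t: "t \<noteq> {}" "t \<subseteq> {0<..N}"
    and c: "\<forall>f\<in>ext ` F. idx (col (a \<otimes> finprod G f t)) = c" unfolding monochromatic_def by blast
  have ac: "a \<in> carrier G" using a S by auto
  have inW: "a \<otimes> finprod G (ext f) t \<in> W" if "f \<in> F" for f
    using that a t unfolding W_def by force
  obtain h where h: "h \<in> carrier G" "\<forall>f\<in>F. col (a \<otimes> finprod G (ext f) t) = h"
  proof (cases "F = {}")
    case True
    then show ?thesis using that[of \<one>] by auto
  next
    case False
    then obtain f1 where f1: "f1 \<in> F" by auto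
    have "col (a \<otimes> finprod G (ext f) t) = col (a \<otimes> finprod G (ext f1) t)" if "f \<in> F" for f
      using c f1 that inW W(2) col(1) by (intro inj_onD[OF idx(2)]) auto
    moreover have "col (a \<otimes> finprod G (ext f1) t) \<in> carrier G"
      using col(1)[of "a \<otimes> finprod G (ext f1) t"] inW[OF f1] W A by blast
    ultimately show ?thesis using that by blast
  qed
  have t1: "t \<subseteq> {1..}" using t(2) by auto
  have "inv h \<otimes> a \<otimes> g \<otimes> finprod G f t \<in> X" if f: "f \<in> F" for f
  proof -
    have "inv h \<otimes> (a \<otimes> finprod G (ext f) t) \<otimes> g \<in> X"
      using col(2)[of "a \<otimes> finprod G (ext f) t"] inW[OF f] W h f by auto
    then show ?thesis using ext_eq[OF f t1] ft[OF f, of t] h(1) ac g(1) by (simp add: m_ac)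
  qed
  then show "\<exists>a\<in>carrier G. \<exists>t. finite t \<and> t \<noteq> {} \<and> t \<subseteq> {1..} \<and> (\<forall>f\<in>F. a \<otimes> finprod G f t \<in> X)"
    using h ac g t t1 by (intro bexI[of _ "inv h \<otimes> a \<otimes> g"] exI[of _ t]) (auto intro: finite_subset)
qed

section \<open>Nongeneric J-sets contain long order patterns\<close>

text \<open>The elements \<open>h 0, h 1, \<dots>\<close> are chosen one after the other, for all \<open>p \<in> T\<close> at once.  If for a \<open>p\<close>
  some \<open>a\<close> multiplies all \<open>p j \<cdot> h j\<close>, \<open>j < n\<close>, into \<open>X\<close>, the induction hypothesis gives a pattern \<open>a 0, \<dots>, a (n - 1)\<close>
  for \<open>p\<close>.  The next element \<open>h n\<close> must satisfy \<open>a i \<cdot> p n \<cdot> h n \<notin> X\<close> for the finitely many \<open>i < n\<close> and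
  \<open>p \<in> T\<close>, which is possible because finitely many translates of \<open>X\<close> do not cover the group.  If there
  is still such an \<open>a\<close> for all \<open>j \<le> n\<close>, it serves as \<open>a n\<close>.\<close>

lemma greedy_chains:
  assumes X: "X \<subseteq> carrier G" "\<not> generic G X" and T: "finite T" "\<forall>p\<in>T. \<forall>j. p j \<in> carrier G"
  shows "\<exists>h. (\<forall>j::nat. h j \<in> carrier G) \<and>
    (\<forall>p\<in>T. (\<exists>a\<in>carrier G. \<forall>j<n. a \<otimes> (p j \<otimes> h j) \<in> X) \<longrightarrow>
       (\<exists>a. (\<forall>i. a i \<in> carrier G) \<and> (\<forall>i<n. \<forall>j<n. a i \<otimes> (p j \<otimes> h j) \<in> X \<longleftrightarrow> j \<le> i)))"
proof (induction n)
  case 0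
  show ?case by (auto intro!: exI[of _ "\<lambda>_. \<one>"])
next
  case (Suc n)
  then obtain h where h: "\<And>j. h j \<in> carrier G" and
    H: "\<And>p. p \<in> T \<Longrightarrow> \<exists>a\<in>carrier G. \<forall>j<n. a \<otimes> (p j \<otimes> h j) \<in> X \<Longrightarrow>
       \<exists>a. (\<forall>i. a i \<in> carrier G) \<and> (\<forall>i<n. \<forall>j<n. a i \<otimes> (p j \<otimes> h j) \<in> X \<longleftrightarrow> j \<le> i)"
    by blast
  then have "\<forall>p. \<exists>a. p \<in> T \<longrightarrow> (\<exists>a\<in>carrier G. \<forall>j<n. a \<otimes> (p j \<otimes> h j) \<in> X) \<longrightarrow>
    (\<forall>i. a i \<in> carrier G) \<and> (\<forall>i<n. \<forall>j<n. a i \<otimes> (p j \<otimes> h j) \<in> X \<longleftrightarrow> j \<le> i)" by blast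
  then obtain a where a: "\<And>p. p \<in> T \<Longrightarrow> \<exists>a\<in>carrier G. \<forall>j<n. a \<otimes> (p j \<otimes> h j) \<in> X \<Longrightarrow>
    (\<forall>i. a p i \<in> carrier G) \<and> (\<forall>i<n. \<forall>j<n. a p i \<otimes> (p j \<otimes> h j) \<in> X \<longleftrightarrow> j \<le> i)" by metis
  \<comment> \<open>For a \<open>p\<close> without such a common multiplier the values of \<open>a p\<close> are arbitrary and may lie outside the group.\<close>
  define W where "W = (\<lambda>(p, i). a p i \<otimes> p n) ` (T \<times> {..<n}) \<inter> carrier G"
  have "finite W" "W \<subseteq> carrier G" using T by (auto simp: W_def)
  from non_generic_avoids_translates[OF X(2,1) this]
  obtain g where g: "g \<in> carrier G" "\<forall>w\<in>W. w \<otimes> g \<notin> X" by blast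
  have "\<exists>b. (\<forall>i. b i \<in> carrier G) \<and>
      (\<forall>i<Suc n. \<forall>j<Suc n. b i \<otimes> (p j \<otimes> (h(n := g)) j) \<in> X \<longleftrightarrow> j \<le> i)"
    if p: "p \<in> T" and e: "\<exists>a\<in>carrier G. \<forall>j<Suc n. a \<otimes> (p j \<otimes> (h(n := g)) j) \<in> X" for p
  proof -
    from e obtain z where z: "z \<in> carrier G" "\<And>j. j < Suc n \<Longrightarrow> z \<otimes> (p j \<otimes> (h(n := g)) j) \<in> X" by blast
    have zj: "z \<otimes> (p j \<otimes> h j) \<in> X" if "j < n" for j using z(2)[of j] that by simp
    with z(1) a[OF p] have ap: "\<And>i. a p i \<in> carrier G"
      "\<And>i j. i < n \<Longrightarrow> j < n \<Longrightarrow> a p i \<otimes> (p j \<otimes> h j) \<in> X \<longleftrightarrow> j \<le> i" by blast+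
    have out: "a p i \<otimes> (p n \<otimes> g) \<notin> X" if "i < n" for i
    proof -
      have "a p i \<otimes> p n \<in> W" unfolding W_def using p that ap(1) T by force
      then show ?thesis using g ap(1)[of i] bspec[OF T(2) p] by (auto simp: m_assoc)
    qed
    have "z \<otimes> (p n \<otimes> g) \<in> X" using z(2)[of n] by simp
    with zj show ?thesis
      by (intro exI[of _ "(a p)(n := z)"]) (use z(1) ap out in \<open>auto simp: less_Suc_eq\<close>)
  qed
  then show ?case using h g by (intro exI[of _ "h(n := g)"]) auto
qed

text \<open>If there is no pattern of length \<open>n\<close>, the greedy choice produces, for any finite set \<open>T\<close> of tuples \<open>p\<close>,
  a tuple \<open>h\<close> such that no \<open>a\<close> satisfies \<open>a \<cdot> p j \<cdot> h j \<in> X\<close> for all \<open>j < n\<close>.  Iterate this: at stage \<open>s\<close> let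
  \<open>T s\<close> contain the tuples of products over all sets of earlier stages.  The result is a family of \<open>n\<close>
  sequences, the \<open>j\<close>-th one being \<open>s \<mapsto> h s j\<close>, that refutes that \<open>X\<close> is a J-set, since the products over
  a nonempty \<open>t\<close> are of the form \<open>p j \<cdot> h s j\<close> for \<open>s = Max t\<close> and \<open>p \<in> T s\<close>.\<close>

lemma nongeneric_J_set_chains:
  fixes n :: nat
  assumes J: "J_set G X" and ng: "\<not> generic G X"
  shows "\<exists>a g. (\<forall>i. a i \<in> carrier G \<and> g i \<in> carrier G) \<and>
    (\<forall>i<n. \<forall>j<n. a i \<otimes> g j \<in> X \<longleftrightarrow> j \<le> i)"
proof (rule ccontr)
  assume no: "\<not> ?thesis"
  have X: "X \<subseteq> carrier G" using J by (simp add: J_set_def)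
  let ?ok = "\<lambda>(T :: (nat \<Rightarrow> 'a) set) h. (\<forall>j. h j \<in> carrier G) \<and>
      (\<forall>p\<in>T. \<not> (\<exists>a\<in>carrier G. \<forall>j<n. a \<otimes> (p j \<otimes> h j) \<in> X))"
  have "\<exists>h. ?ok T h" if T: "finite T" "\<forall>p\<in>T. \<forall>j. p j \<in> carrier G"
    for T :: "(nat \<Rightarrow> 'a) set"
  proof -
    from greedy_chains[OF X ng T, where n = n] obtain h where h: "\<forall>j. h j \<in> carrier G"
      "\<And>p. p \<in> T \<Longrightarrow> \<exists>a\<in>carrier G. \<forall>j<n. a \<otimes> (p j \<otimes> h j) \<in> X \<Longrightarrow>
       \<exists>a. (\<forall>i. a i \<in> carrier G) \<and> (\<forall>i<n. \<forall>j<n. a i \<otimes> (p j \<otimes> h j) \<in> X \<longleftrightarrow> j \<le> i)" by blast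
    have "\<not> (\<exists>a\<in>carrier G. \<forall>j<n. a \<otimes> (p j \<otimes> h j) \<in> X)" if p: "p \<in> T" for p
    proof
      assume "\<exists>a\<in>carrier G. \<forall>j<n. a \<otimes> (p j \<otimes> h j) \<in> X"
      from h(2)[OF p this] obtain a where "\<forall>i. a i \<in> carrier G"
        "\<forall>i<n. \<forall>j<n. a i \<otimes> (p j \<otimes> h j) \<in> X \<longleftrightarrow> j \<le> i" by blast
      then have "\<exists>a g. (\<forall>i. a i \<in> carrier G \<and> g i \<in> carrier G) \<and>
          (\<forall>i<n. \<forall>j<n. a i \<otimes> g j \<in> X \<longleftrightarrow> j \<le> i)"
        using h(1) bspec[OF T(2) p] by (intro exI[of _ a] exI[of _ "\<lambda>j. p j \<otimes> h j"]) simp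
      with no show False by contradiction
    qed
    with h(1) show ?thesis by blast
  qed
  then obtain H where H: "\<And>T. finite T \<Longrightarrow> \<forall>p\<in>T. \<forall>j. p j \<in> carrier G \<Longrightarrow> ?ok T (H T)"
    by metis
  define T where "T = rec_nat {\<lambda>_. \<one>} (\<lambda>_ T. T \<union> (\<lambda>p j. p j \<otimes> H T j) ` T)"
  have T0: "T 0 = {\<lambda>_. \<one>}" and TS: "\<And>s. T (Suc s) = T s \<union> (\<lambda>p j. p j \<otimes> H (T s) j) ` T s"
    by (simp_all add: T_def)
  have T: "finite (T s) \<and> (\<forall>p\<in>T s. \<forall>j. p j \<in> carrier G)" for s
  proof (induction s)
    case 0
    then show ?case by (simp add: T0)
  next
    case (Suc s)
    then show ?case using H[of "T s"] by (auto simp: TS)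
  qed
  define h where "h s = H (T s)" for s
  have hc: "h s j \<in> carrier G" and hok: "p \<in> T s \<Longrightarrow> a \<in> carrier G \<Longrightarrow> \<exists>j<n. a \<otimes> (p j \<otimes> h s j) \<notin> X"
    for s j p a using H[of "T s"] T[of s] unfolding h_def by blast+
  have fin: "(\<lambda>j. finprod G (\<lambda>s. h s j) t) \<in> T s" if "t \<subseteq> {..<s}" for t s
    using that
  proof (induction s arbitrary: t)
    case 0
    then show ?case by (simp add: T0)
  next
    case (Suc s)
    have IH: "(\<lambda>j. finprod G (\<lambda>s. h s j) (t - {s})) \<in> T s"
      using Suc.prems by (intro Suc.IH) (auto simp: less_Suc_eq)
    show ?case
    proof (cases "s \<in> t")
      case True
      have "finprod G (\<lambda>s. h s j) t = finprod G (\<lambda>s. h s j) (t - {s}) \<otimes> h s j" for j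
      proof -
        have "finprod G (\<lambda>s. h s j) (insert s (t - {s})) = h s j \<otimes> finprod G (\<lambda>s. h s j) (t - {s})"
          using Suc.prems hc by (intro finprod_insert) (auto intro: finite_subset)
        moreover have "finprod G (\<lambda>s. h s j) (t - {s}) \<in> carrier G" using hc by (auto intro!: finprod_closed)
        ultimately show ?thesis using True hc by (simp add: insert_absorb m_comm)
      qed
      then show ?thesis using IH by (auto simp: TS h_def)
    next
      case False
      then show ?thesis using IH by (auto simp: TS)
    qed
  qed
  define F where "F = (\<lambda>j. \<lambda>s\<in>{1..}. h s j) ` {..<n}"
  have "finite F" "F \<subseteq> ({1..} \<rightarrow>\<^sub>E carrier G)" 
    using hc unfolding F_def by (auto intro!: restrict_PiE_iff[THEN iffD2])
  with J[unfolded J_set_iff] obtain a t where a: "a \<in> carrier G" and t: "finite t" "t \<noteq> {}" "t \<subseteq> {1..}"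
    and aF: "\<forall>f\<in>F. a \<otimes> finprod G f t \<in> X" by meson
  define s where "s = Max t"
  have s: "s \<in> t" "t - {s} \<subseteq> {..<s}" using t Max_ge[of t] by (auto simp: s_def order.strict_iff_order)
  obtain j where j: "j < n" "a \<otimes> (finprod G (\<lambda>s. h s j) (t - {s}) \<otimes> h s j) \<notin> X"
    using hok[OF fin[OF s(2)] a] by blast
  have "finprod G (\<lambda>s. h s j) (insert s (t - {s})) = h s j \<otimes> finprod G (\<lambda>s. h s j) (t - {s})"
    using t hc by (intro finprod_insert) auto
  moreover have "finprod G (\<lambda>s. h s j) (t - {s}) \<in> carrier G" using hc by (auto intro!: finprod_closed)
  moreover have "finprod G (\<lambda>s\<in>{1..}. h s j) t = finprod G (\<lambda>s. h s j) t"
    using t hc by (intro finprod_cong') auto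
  moreover have "a \<otimes> finprod G (\<lambda>s\<in>{1..}. h s j) t \<in> X" using aF j by (auto simp: F_def)
  ultimately show False using j s hc by (simp add: insert_absorb m_comm)
qed

end

section \<open>Renaming variables\<close>

lemma finite_fv_tm: "finite (fv_tm t)"
  by (induction t) auto

lemma finite_fv_fm: "finite (fv_fm \<phi>)"
  by (induction \<phi>) (auto simp: finite_fv_tm)

lemma eval_tm_cong: "(\<And>v. v \<in> fv_tm t \<Longrightarrow> e v = e' v) \<Longrightarrow> eval_tm M e t = eval_tm M e' t"
proof (induction t)
  case (Fn f ts)
  have "map (eval_tm M e) ts = map (eval_tm M e') ts"
    using Fn by (intro map_cong refl) auto
  then show ?case by (simp only: eval_tm.simps)
qed simp

lemma sat_cong: "(\<And>v. v \<in> fv_fm \<phi> \<Longrightarrow> e v = e' v) \<Longrightarrow> sat M e \<phi> = sat M e' \<phi>"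
proof (induction \<phi> arbitrary: e e')
  case (Eq s t)
  have "eval_tm M e s = eval_tm M e' s" "eval_tm M e t = eval_tm M e' t"
    using Eq by (auto intro: eval_tm_cong)
  then show ?case by simp
next
  case (Rel r ts)
  have "map (eval_tm M e) ts = map (eval_tm M e') ts"
    using Rel by (intro map_cong refl eval_tm_cong) auto
  then show ?case by (simp only: sat.simps)
next
  case (Neg \<phi>)
  then show ?case by (metis fv_fm.simps(3) sat.simps(3))
next
  case (And \<phi> \<psi>)
  have "sat M e \<phi> = sat M e' \<phi>" "sat M e \<psi> = sat M e' \<psi>"
    using And.prems by (auto intro!: And.IH)
  then show ?case by simp
next
  case (Ex i \<phi>)
  have "sat M (e(i := x)) \<phi> = sat M (e'(i := x)) \<phi>" for x
    using Ex.prems by (intro Ex.IH) auto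
  then show ?case by simp
qed

fun ren_tm :: "(nat \<Rightarrow> nat) \<Rightarrow> 'f tm \<Rightarrow> 'f tm" where
  "ren_tm \<sigma> (Var i) = Var (\<sigma> i)"
| "ren_tm \<sigma> (Fn f ts) = Fn f (map (ren_tm \<sigma>) ts)"

definition fresh :: "nat set \<Rightarrow> nat" where
  "fresh V = Suc (Max (insert 0 V))"

lemma fresh_notin: "finite V \<Longrightarrow> fresh V \<notin> V"
  unfolding fresh_def by (metis Max_ge finite.insertI insertCI not_less_eq_eq order_refl)

text \<open>Simultaneous renaming of free variables; bound variables are replaced by fresh ones to avoid capture.\<close>

fun ren :: "(nat \<Rightarrow> nat) \<Rightarrow> ('f, 'r) fm \<Rightarrow> ('f, 'r) fm" where
  "ren \<sigma> (Eq s t) = Eq (ren_tm \<sigma> s) (ren_tm \<sigma> t)"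
| "ren \<sigma> (Rel r ts) = Rel r (map (ren_tm \<sigma>) ts)"
| "ren \<sigma> (Neg \<phi>) = Neg (ren \<sigma> \<phi>)"
| "ren \<sigma> (And \<phi> \<psi>) = And (ren \<sigma> \<phi>) (ren \<sigma> \<psi>)"
| "ren \<sigma> (Ex i \<phi>) =
     (let j = fresh (\<sigma> ` (fv_fm \<phi> - {i})) in Ex j (ren (\<sigma>(i := j)) \<phi>))"

lemma eval_ren_tm: "eval_tm M e (ren_tm \<sigma> t) = eval_tm M (e \<circ> \<sigma>) t"
proof (induction t)
  case (Fn f ts)
  have "map (eval_tm M e) (map (ren_tm \<sigma>) ts) = map (eval_tm M (e \<circ> \<sigma>)) ts"
    unfolding map_map using Fn by (intro map_cong refl) (simp add: comp_def)
  then show ?case by (simp only: eval_tm.simps ren_tm.simps)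
qed simp

lemma wf_ren_tm: "wf_tm L (ren_tm \<sigma> t) = wf_tm L t"
  by (induction t) auto

lemma fv_ren_tm: "fv_tm (ren_tm \<sigma> t) = \<sigma> ` fv_tm t"
  by (induction t) auto

lemma sat_ren: "sat M e (ren \<sigma> \<phi>) = sat M (e \<circ> \<sigma>) \<phi>"
proof (induction \<phi> arbitrary: e \<sigma>)
  case (Rel r ts)
  have "map (eval_tm M e) (map (ren_tm \<sigma>) ts) = map (eval_tm M (e \<circ> \<sigma>)) ts"
    by (simp add: eval_ren_tm)
  then show ?case by (simp only: sat.simps ren.simps)
next
  case (Ex i \<phi>)
  let ?j = "fresh (\<sigma> ` (fv_fm \<phi> - {i}))"
  have j: "?j \<notin> \<sigma> ` (fv_fm \<phi> - {i})" by (intro fresh_notin) (simp add: finite_fv_fm)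
  have "sat M (e(?j := x) \<circ> \<sigma>(i := ?j)) \<phi> = sat M ((e \<circ> \<sigma>)(i := x)) \<phi>" for x
  proof (rule sat_cong)
    fix v assume "v \<in> fv_fm \<phi>"
    then have "v = i \<or> \<sigma> v \<noteq> ?j" using j by (metis DiffI imageI singletonD)
    then show "(e(?j := x) \<circ> \<sigma>(i := ?j)) v = ((e \<circ> \<sigma>)(i := x)) v" by auto
  qed
  then show ?case unfolding ren.simps Let_def sat.simps Ex by simp
qed (simp_all add: eval_ren_tm)

lemma wf_ren: "wf_fm L (ren \<sigma> \<phi>) = wf_fm L \<phi>"
  by (induction \<phi> arbitrary: \<sigma>) (auto simp: wf_ren_tm Let_def)

lemma fv_ren: "fv_fm (ren \<sigma> \<phi>) \<subseteq> \<sigma> ` fv_fm \<phi>"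
proof (induction \<phi> arbitrary: \<sigma>)
  case (Ex i \<phi>)
  let ?j = "fresh (\<sigma> ` (fv_fm \<phi> - {i}))"
  have "fv_fm (ren (\<sigma>(i := ?j)) \<phi>) \<subseteq> (\<sigma>(i := ?j)) ` fv_fm \<phi>" by (rule Ex)
  then show ?case by (auto simp: Let_def split: if_splits)
next
  case (And \<phi> \<psi>)
  then show ?case by (simp add: image_Un) blast
qed (auto simp: fv_ren_tm)

text \<open>The formula \<open>\<phi>\<close> read off at the variables \<open>vs\<close>.  Together with the next two lemmas this reduces any
  change of the order or of the number of variables to a computation with lists.\<close>

definition inst :: "('f, 'r) fm \<Rightarrow> nat list \<Rightarrow> ('f, 'r) fm" where
  "inst \<phi> vs = ren ((!) vs) \<phi>"

lemma sat_inst: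
  assumes "fv_fm \<phi> \<subseteq> {..<length vs}"
  shows "sat M e (inst \<phi> vs) = holds M \<phi> (map e vs)"
  unfolding inst_def holds_def sat_ren using assms by (intro sat_cong) auto

lemma holds_inst:
  assumes "fv_fm \<phi> \<subseteq> {..<length vs}"
  shows "holds M (inst \<phi> vs) zs = holds M \<phi> (map ((!) zs) vs)"
  unfolding holds_def[of M "inst \<phi> vs"] by (rule sat_inst[OF assms])

lemma wf_inst: "wf_fm L (inst \<phi> vs) = wf_fm L \<phi>"
  by (simp add: inst_def wf_ren)

lemma fv_inst: "fv_fm \<phi> \<subseteq> {..<length vs} \<Longrightarrow> fv_fm (inst \<phi> vs) \<subseteq> set vs"
  unfolding inst_def using fv_ren[of "(!) vs" \<phi>] by (auto simp: subset_iff dest!: nth_mem)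

lemma map_nth_upt: "j \<le> length zs \<Longrightarrow> map ((!) zs) [i..<j] = take (j - i) (drop i zs)"
  by (intro nth_equalityI) auto

section \<open>Formulas about blocks of variables\<close>

definition exs :: "nat \<Rightarrow> nat \<Rightarrow> ('f, 'r) fm \<Rightarrow> ('f, 'r) fm" where
  "exs s n \<phi> = foldr Ex [s..<s + n] \<phi>"

lemma tuples_Suc: "tuples M (Suc n) = (\<lambda>(x, xs). x # xs) ` (dom M \<times> tuples M n)"
  by (auto simp: tuples_def image_iff length_Suc_conv)

lemma sat_exs:
  "sat M e (exs s n \<phi>) \<longleftrightarrow>
    (\<exists>xs\<in>tuples M n. sat M (\<lambda>v. if s \<le> v \<and> v < s + n then xs ! (v - s) else e v) \<phi>)"
proof (induction n arbitrary: s e)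
  case 0
  have "(\<lambda>v. if s \<le> v \<and> v < s then xs ! (v - s) else e v) = e" for xs
    by (auto simp: fun_eq_iff)
  then show ?case by (simp add: exs_def tuples_def)
next
  case (Suc n)
  have "[s..<s + Suc n] = s # [Suc s..<Suc s + n]" by (simp add: upt_conv_Cons)
  then have "exs s (Suc n) \<phi> = Ex s (exs (Suc s) n \<phi>)" by (simp add: exs_def)
  moreover have "(\<lambda>v. if Suc s \<le> v \<and> v < Suc s + n then xs ! (v - Suc s) else (e(s := x)) v) =
      (\<lambda>v. if s \<le> v \<and> v < s + Suc n then (x # xs) ! (v - s) else e v)" for x xs
    by (auto simp: fun_eq_iff nth_Cons' Suc_le_eq)
  ultimately show ?case by (auto simp: Suc tuples_Suc)
qed

lemma wf_exs: "wf_fm L (exs s n \<phi>) = wf_fm L \<phi>"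
proof -
  have "wf_fm L (foldr Ex vs \<phi>) = wf_fm L \<phi>" for vs by (induction vs) auto
  then show ?thesis by (simp add: exs_def)
qed

lemma fv_exs: "fv_fm (exs s n \<phi>) = fv_fm \<phi> - {s..<s + n}"
proof -
  have "fv_fm (foldr Ex vs \<phi>) = fv_fm \<phi> - set vs" for vs by (induction vs) auto
  then show ?thesis by (simp add: exs_def)
qed

lemma holds_exs:
  assumes "length zs = s" "fv_fm \<phi> \<subseteq> {..<s + n}"
  shows "holds M (exs s n \<phi>) zs \<longleftrightarrow> (\<exists>xs\<in>tuples M n. holds M \<phi> (zs @ xs))"
  unfolding holds_def sat_exs
proof (rule bex_cong[OF refl])
  fix xs assume "xs \<in> tuples M n"
  show "sat M (\<lambda>v. if s \<le> v \<and> v < s + n then xs ! (v - s) else zs ! v) \<phi> = sat M ((!) (zs @ xs)) \<phi>"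
    using assms by (intro sat_cong) (auto simp: nth_append)
qed

definition verum :: "('f, 'r) fm" where
  "verum = Ex 0 (Eq (Var 0) (Var 0))"

lemma sat_verum: "is_structure L M \<Longrightarrow> sat M e verum"
  by (auto simp: verum_def is_structure_def)

text \<open>Sentences about tuples of elements, such as the group axioms, are written in a language with variables
  \<open>X 0, X 1, \<dots>\<close> for \<open>w\<close>-tuples and with a fixed tuple \<open>c\<close> of \<open>l\<close> parameters; an atom \<open>BAtom \<phi> [i, j]\<close> stands
  for \<open>\<phi>(X i, X j, c)\<close>.  The translation \<open>flatten\<close> into first-order formulas uses the variables
  \<open>0, \<dots>, l - 1\<close> for \<open>c\<close> and the \<open>i\<close>-th block of \<open>w\<close> variables after them for \<open>X i\<close>.\<close>

datatype ('f, 'r) block_fm =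
    BAtom "('f, 'r) fm" "nat list"
  | BTrue
  | BNeg "('f, 'r) block_fm"
  | BAnd "('f, 'r) block_fm" "('f, 'r) block_fm"
  | BEx nat "('f, 'r) block_fm"

definition block :: "nat \<Rightarrow> nat \<Rightarrow> nat \<Rightarrow> nat list" where
  "block l w i = [l + i * w..<l + i * w + w]"

fun block_wf :: "('f, 'r) lang \<Rightarrow> nat \<Rightarrow> nat \<Rightarrow> ('f, 'r) block_fm \<Rightarrow> bool" where
  "block_wf L l w (BAtom \<phi> is) = (wf_fm L \<phi> \<and> fv_fm \<phi> \<subseteq> {..<length is * w + l})"
| "block_wf L l w BTrue = True"
| "block_wf L l w (BNeg b) = block_wf L l w b"
| "block_wf L l w (BAnd b b') = (block_wf L l w b \<and> block_wf L l w b')"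
| "block_wf L l w (BEx i b) = block_wf L l w b"

fun block_fv :: "('f, 'r) block_fm \<Rightarrow> nat set" where
  "block_fv (BAtom \<phi> is) = set is"
| "block_fv BTrue = {}"
| "block_fv (BNeg b) = block_fv b"
| "block_fv (BAnd b b') = block_fv b \<union> block_fv b'"
| "block_fv (BEx i b) = block_fv b - {i}"

fun block_sat :: "('f, 'r, 'a) struct \<Rightarrow> 'a list \<Rightarrow> nat \<Rightarrow> (nat \<Rightarrow> 'a list) \<Rightarrow> ('f, 'r) block_fm \<Rightarrow> bool" where
  "block_sat M c w X (BAtom \<phi> is) = holds M \<phi> (concat (map X is) @ c)"
| "block_sat M c w X BTrue = True"
| "block_sat M c w X (BNeg b) = (\<not> block_sat M c w X b)"
| "block_sat M c w X (BAnd b b') = (block_sat M c w X b \<and> block_sat M c w X b')"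
| "block_sat M c w X (BEx i b) = (\<exists>x\<in>tuples M w. block_sat M c w (X(i := x)) b)"

fun flatten :: "nat \<Rightarrow> nat \<Rightarrow> ('f, 'r) block_fm \<Rightarrow> ('f, 'r) fm" where
  "flatten l w (BAtom \<phi> is) = inst \<phi> (concat (map (block l w) is) @ [0..<l])"
| "flatten l w BTrue = verum"
| "flatten l w (BNeg b) = Neg (flatten l w b)"
| "flatten l w (BAnd b b') = And (flatten l w b) (flatten l w b')"
| "flatten l w (BEx i b) = exs (l + i * w) w (flatten l w b)"

definition env :: "'a list \<Rightarrow> nat \<Rightarrow> (nat \<Rightarrow> 'a list) \<Rightarrow> nat \<Rightarrow> 'a" where
  "env c w X v = (if v < length c then c ! v else X ((v - length c) div w) ! ((v - length c) mod w))"

lemma length_block: "length (block l w i) = w"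
  by (simp add: block_def)

lemma length_concat_block: "length (concat (map (block l w) is)) = length is * w"
  by (induction "is") (auto simp: length_block)

lemma env_params: "map (env c w X) [0..<length c] = c"
  by (intro nth_equalityI) (auto simp: env_def)

lemma env_block: "length (X i) = w \<Longrightarrow> map (env c w X) (block (length c) w i) = X i"
  by (intro nth_equalityI) (auto simp: env_def block_def)

lemma env_blocks:
  "(\<And>i. length (X i) = w) \<Longrightarrow> map (env c w X) (concat (map (block (length c) w) is)) = concat (map X is)"
  by (induction "is") (auto simp: env_block)

lemma env_update:
  assumes "\<And>i. length (X i) = w" "length x = w" "l = length c"
  shows "(\<lambda>v. if l + i * w \<le> v \<and> v < l + i * w + w then x ! (v - (l + i * w)) else env c w X v) =
    env c w (X(i := x))"
proof (cases "w = 0")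
  case True
  \<comment> \<open>For \<open>w = 0\<close> all blocks coincide, but there is only one \<open>0\<close>-tuple.\<close>
  then have "X(i := x) = X" using assms(1)[of i] assms(2) by (intro fun_upd_idem) simp
  then show ?thesis using True by (intro ext) (auto simp del: fun_upd_apply)
next
  case False
  show ?thesis
  proof
    fix v
    show "(if l + i * w \<le> v \<and> v < l + i * w + w then x ! (v - (l + i * w)) else env c w X v) =
      env c w (X(i := x)) v"
    proof (cases "v < l")
      case True
      then show ?thesis using assms by (auto simp: env_def)
    next
      case vl: False
      define u where "u = v - l"
      have v: "v = l + u" using vl by (simp add: u_def)
      have "(i * w \<le> u \<and> u < i * w + w) \<longleftrightarrow> u div w = i"
        using False by (metis add.commute div_nat_eqI dividend_less_times_div div_times_less_eq_dividend
            mult.commute mult_Suc neq0_conv)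
      moreover have "u mod w = u - i * w" if "u div w = i"
        using that by (metis minus_div_mult_eq_mod)
      ultimately show ?thesis using assms v by (auto simp: env_def)
    qed
  qed
qed

lemma sat_flatten:
  assumes "is_structure L M" "block_wf L (length c) w b" "\<And>i. X i \<in> tuples M w"
  shows "sat M (env c w X) (flatten (length c) w b) = block_sat M c w X b"
  using assms(2,3)
proof (induction b arbitrary: X)
  case (BAtom \<phi> "is")
  have "length (X i) = w" for i using BAtom.prems by (auto simp: tuples_def)
  then show ?case using BAtom.prems
    by (simp add: sat_inst length_concat_block env_blocks env_params)
next
  case BTrue
  then show ?case using sat_verum[OF assms(1)] by simp
next
  case (BEx i b)
  have len: "\<And>i. length (X i) = w" using BEx.prems by (auto simp: tuples_def)
  show ?case unfolding flatten.simps block_sat.simps sat_exs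
  proof (rule bex_cong[OF refl])
    fix x assume x: "x \<in> tuples M w"
    then have "length x = w" by (simp add: tuples_def)
    note upd = env_update[of X, OF len this refl, of c i]
    have "sat M (env c w (X(i := x))) (flatten (length c) w b) = block_sat M c w (X(i := x)) b"
      using x BEx.prems by (intro BEx.IH) auto
    then show "sat M (\<lambda>v. if length c + i * w \<le> v \<and> v < length c + i * w + w
         then x ! (v - (length c + i * w)) else env c w X v) (flatten (length c) w b) =
       block_sat M c w (X(i := x)) b" unfolding upd .
  qed
qed simp_all

lemma wf_flatten: "block_wf L l w b \<Longrightarrow> wf_fm L (flatten l w b)"
  by (induction b) (auto simp: wf_inst wf_exs verum_def)

lemma fv_flatten: "block_wf L l w b \<Longrightarrow> fv_fm (flatten l w b) \<subseteq> {..<l} \<union> (\<Union>i\<in>block_fv b. set (block l w i))"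
proof (induction b)
  case (BAtom \<phi> "is")
  then have "fv_fm \<phi> \<subseteq> {..<length (concat (map (block l w) is) @ [0..<l])}"
    by (simp add: length_concat_block)
  from fv_inst[OF this] show ?case by auto
next
  case (BEx i b)
  then show ?case by (auto simp: fv_exs block_def)
qed (auto simp: verum_def)

lemma model_over_is_structure: "model_over L M c N d \<Longrightarrow> is_structure L N"
  by (simp add: model_over_def)

text \<open>Closed block formulas are sentences over \<open>c\<close>, so they pass to every model of the theory of \<open>(M, c)\<close>.  In
  the flattened formula only the parameter variables are free, and hence the values of \<open>X\<close> and \<open>Y\<close> do
  not matter.\<close>

lemma closed_block_fm_transfer:
  assumes M: "is_structure L M" and MN: "model_over L M c N d"
    and b: "block_wf L (length c) w b" "block_fv b = {}"
    and X: "\<And>i. X i \<in> tuples M w" and Y: "\<And>i. Y i \<in> tuples N w"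
  shows "block_sat M c w X b = block_sat N d w Y b"
proof -
  have len: "length d = length c" using MN by (simp add: model_over_def tuples_def)
  have fv: "fv_fm (flatten (length c) w b) \<subseteq> {..<length c}" using fv_flatten[OF b(1)] b(2) by simp
  have "block_sat M c w X b = sat M (env c w X) (flatten (length c) w b)"
    using sat_flatten[of L M c w b X] M b X by simp
  also have "\<dots> = holds M (flatten (length c) w b) c"
    unfolding holds_def using fv by (intro sat_cong) (auto simp: env_def)
  also have "\<dots> = holds N (flatten (length c) w b) d"
    using MN fv wf_flatten[OF b(1)] by (auto simp: model_over_def)
  also have "\<dots> = sat N (env d w Y) (flatten (length d) w b)"
    unfolding holds_def len using fv len by (intro sat_cong) (auto simp: env_def)
  also have "\<dots> = block_sat N d w Y b"
    using sat_flatten[of L N d w b Y] model_over_is_structure[OF MN] b Y len by simp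
  finally show ?thesis .
qed

lemma tuples_nonempty: "is_structure L M \<Longrightarrow> \<exists>x. x \<in> tuples M w"
proof -
  assume "is_structure L M"
  then obtain x where "x \<in> dom M" by (auto simp: is_structure_def)
  then have "replicate w x \<in> tuples M w" by (simp add: tuples_def set_replicate_conv_if)
  then show ?thesis by blast
qed

section \<open>Transfer of the group axioms\<close>

abbreviation "BAll i b \<equiv> BNeg (BEx i (BNeg b))"
abbreviation "BImp b b' \<equiv> BNeg (BAnd b (BNeg b'))"

definition same_tuple :: "nat \<Rightarrow> ('f, 'r) fm" where
  "same_tuple n = foldr And (map (\<lambda>v. Eq (Var v) (Var (n + v))) [0..<n]) verum"

lemma holds_same_tuple:
  assumes "is_structure L M" "length x = n" "length y = n"
  shows "holds M (same_tuple n) (x @ y @ c) \<longleftrightarrow> x = y"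
proof -
  have "sat M e (foldr And (map (\<lambda>v. Eq (Var v) (Var (n + v))) vs) verum) \<longleftrightarrow> (\<forall>v\<in>set vs. e v = e (n + v))"
    for e :: "nat \<Rightarrow> 'c" and vs using sat_verum[OF assms(1)] by (induction vs) auto
  then have "holds M (same_tuple n) (x @ y @ c) \<longleftrightarrow> (\<forall>v<n. x ! v = y ! v)"
    using assms by (auto simp: holds_def same_tuple_def nth_append)
  then show ?thesis using assms by (auto simp: list_eq_iff_nth_eq)
qed

lemma wf_same_tuple: "wf_fm L (same_tuple n)"
proof -
  have "wf_fm L (foldr And (map (\<lambda>v. Eq (Var v) (Var (n + v))) vs) verum)" for vs
    by (induction vs) (auto simp: verum_def)
  then show ?thesis by (simp add: same_tuple_def)
qed

lemma fv_same_tuple: "fv_fm (same_tuple n) \<subseteq> {..<2 * n + l}"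
proof -
  have "fv_fm (foldr And (map (\<lambda>v. Eq (Var v) (Var (n + v))) vs) verum) \<subseteq> set vs \<union> (+) n ` set vs" for vs
    by (induction vs) (auto simp: verum_def)
  from this[of "[0..<n]"] show ?thesis
    unfolding same_tuple_def by (rule order_trans) auto
qed

text \<open>The axioms of a commutative group in terms of the graph \<open>R\<close> of the multiplication.  They are nested
  exactly as in the block formula below, so that both sides agree after unfolding.\<close>

definition comm_group_relation :: "'a set \<Rightarrow> ('a \<Rightarrow> 'a \<Rightarrow> 'a \<Rightarrow> bool) \<Rightarrow> bool" where
  "comm_group_relation S R \<longleftrightarrow>
     (\<forall>x\<in>S. \<forall>y\<in>S. \<exists>z\<in>S. R x y z \<and> (\<forall>z'\<in>S. R x y z' \<longrightarrow> z = z')) \<and>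
     (\<forall>x\<in>S. \<forall>y\<in>S. \<forall>z\<in>S. \<exists>u\<in>S. R x y u \<and> (\<exists>v\<in>S. R y z v \<and> (\<exists>w\<in>S. R u z w \<and> R x v w))) \<and>
     (\<exists>u\<in>S. \<forall>x\<in>S. R u x x \<and> (\<exists>y\<in>S. R y x u)) \<and>
     (\<forall>x\<in>S. \<forall>y\<in>S. \<forall>z\<in>S. R x y z \<longrightarrow> R y x z)"

abbreviation mult_rel :: "('f, 'r, 'a) struct \<Rightarrow> ('f, 'r) dgroup \<Rightarrow> 'a list \<Rightarrow> 'a list \<Rightarrow> 'a list \<Rightarrow> 'a list \<Rightarrow> bool" where
  "mult_rel M G c x y z \<equiv> holds M (mult_fm G) (x @ y @ z @ c)"

lemma carrier_points: "carrier (points M G c) = univ M G c"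
  by (simp add: points_def Let_def)

lemma mult_points:
  "x \<otimes>\<^bsub>points M G c\<^esub> y = (THE z. z \<in> univ M G c \<and> mult_rel M G c x y z)"
  by (simp add: points_def Let_def)

lemma one_points: "\<one>\<^bsub>points M G c\<^esub> = (THE u. u \<in> univ M G c \<and>
    (\<forall>x\<in>univ M G c. u \<otimes>\<^bsub>points M G c\<^esub> x = x \<and> x \<otimes>\<^bsub>points M G c\<^esub> u = x))"
  by (simp add: points_def Let_def)

lemma mult_points_iff:
  assumes "\<exists>!z. z \<in> univ M G c \<and> mult_rel M G c x y z" "z \<in> univ M G c"
  shows "x \<otimes>\<^bsub>points M G c\<^esub> y = z \<longleftrightarrow> mult_rel M G c x y z"
  unfolding mult_points using assms theI'[OF assms(1)] by (metis (no_types, lifting))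

lemma comm_group_relation_points:
  assumes "definable_group L M G c" "comm_group (points M G c)"
  shows "comm_group_relation (univ M G c) (mult_rel M G c)"
proof -
  let ?P = "points M G c"
  interpret comm_group ?P by fact
  have iff: "mult_rel M G c x y z \<longleftrightarrow> x \<otimes>\<^bsub>?P\<^esub> y = z"
    if "x \<in> carrier ?P" "y \<in> carrier ?P" "z \<in> carrier ?P" for x y z
    using mult_points_iff[of M G c x y z] assms(1) that
    unfolding definable_group_def carrier_points by blast
  show ?thesis
    unfolding comm_group_relation_def carrier_points[symmetric]
  proof (intro conjI ballI impI)
    fix x y assume xy: "x \<in> carrier ?P" "y \<in> carrier ?P"
    then show "\<exists>z\<in>carrier ?P. mult_rel M G c x y z \<and> (\<forall>z'\<in>carrier ?P. mult_rel M G c x y z' \<longrightarrow> z = z')"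
      by (intro bexI[of _ "x \<otimes>\<^bsub>?P\<^esub> y"]) (auto simp: iff)
    fix z assume z: "z \<in> carrier ?P"
    show "\<exists>u\<in>carrier ?P. mult_rel M G c x y u \<and> (\<exists>v\<in>carrier ?P. mult_rel M G c y z v \<and>
        (\<exists>w\<in>carrier ?P. mult_rel M G c u z w \<and> mult_rel M G c x v w))"
      using xy z by (auto simp: iff m_assoc)
    assume "mult_rel M G c x y z"
    then show "mult_rel M G c y x z" using xy z by (auto simp: iff m_comm)
  next
    show "\<exists>u\<in>carrier ?P. \<forall>x\<in>carrier ?P. mult_rel M G c u x x \<and> (\<exists>y\<in>carrier ?P. mult_rel M G c y x u)"
    proof (rule bexI[of _ "\<one>\<^bsub>?P\<^esub>"], rule ballI, rule conjI)
      fix x assume x: "x \<in> carrier ?P"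
      then show "mult_rel M G c \<one>\<^bsub>?P\<^esub> x x" by (simp add: iff)
      show "\<exists>y\<in>carrier ?P. mult_rel M G c y x \<one>\<^bsub>?P\<^esub>" using x l_inv_ex[OF x] by (auto simp: iff)
    qed simp
  qed
qed

lemma comm_group_pointsI:
  assumes "comm_group_relation (univ M G c) (mult_rel M G c)"
  shows "comm_group (points M G c)"
    and "\<And>x y z. x \<in> univ M G c \<Longrightarrow> y \<in> univ M G c \<Longrightarrow> z \<in> univ M G c \<Longrightarrow>
      mult_rel M G c x y z \<longleftrightarrow> x \<otimes>\<^bsub>points M G c\<^esub> y = z"
proof -
  let ?P = "points M G c"
  note ax = assms[unfolded comm_group_relation_def]
  note ax1 = conjunct1[OF ax] and ax2 = conjunct1[OF conjunct2[OF ax]]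
    and ax3 = conjunct1[OF conjunct2[OF conjunct2[OF ax]]]
    and ax4 = conjunct2[OF conjunct2[OF conjunct2[OF ax]]]
  have ex: "\<exists>!z. z \<in> univ M G c \<and> mult_rel M G c x y z"
    if xy: "x \<in> univ M G c" "y \<in> univ M G c" for x y
  proof -
    obtain z where z: "z \<in> univ M G c \<and> mult_rel M G c x y z"
      "\<forall>z'\<in>univ M G c. mult_rel M G c x y z' \<longrightarrow> z = z'"
      using bspec[OF bspec[OF ax1 xy(1)] xy(2)] by blast
    show ?thesis by (rule ex1I[of _ z], rule z(1)) (use z(2) in blast)
  qed
  have closed: "x \<otimes>\<^bsub>?P\<^esub> y \<in> carrier ?P" if "x \<in> carrier ?P" "y \<in> carrier ?P" for x y
    using conjunct1[OF theI'[OF ex[of x y]]] that unfolding mult_points carrier_points .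
  have iff: "mult_rel M G c x y z \<longleftrightarrow> x \<otimes>\<^bsub>?P\<^esub> y = z"
    if "x \<in> carrier ?P" "y \<in> carrier ?P" "z \<in> carrier ?P" for x y z
    using mult_points_iff[OF ex] that unfolding carrier_points by blast
  then show "\<And>x y z. x \<in> univ M G c \<Longrightarrow> y \<in> univ M G c \<Longrightarrow> z \<in> univ M G c \<Longrightarrow>
      mult_rel M G c x y z \<longleftrightarrow> x \<otimes>\<^bsub>?P\<^esub> y = z" unfolding carrier_points by blast
  have assoc: "x \<otimes>\<^bsub>?P\<^esub> y \<otimes>\<^bsub>?P\<^esub> z = x \<otimes>\<^bsub>?P\<^esub> (y \<otimes>\<^bsub>?P\<^esub> z)"
    if c: "x \<in> carrier ?P" "y \<in> carrier ?P" "z \<in> carrier ?P" for x y z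
  proof -
    obtain u v w where "u \<in> carrier ?P" "v \<in> carrier ?P" "w \<in> carrier ?P"
      "mult_rel M G c x y u" "mult_rel M G c u z w" "mult_rel M G c y z v" "mult_rel M G c x v w"
      using bspec[OF bspec[OF bspec[OF ax2]]] c unfolding carrier_points by blast
    then show ?thesis using c by (simp add: iff)
  qed
  have comm: "x \<otimes>\<^bsub>?P\<^esub> y = y \<otimes>\<^bsub>?P\<^esub> x" if c: "x \<in> carrier ?P" "y \<in> carrier ?P" for x y
  proof -
    have "mult_rel M G c x y (x \<otimes>\<^bsub>?P\<^esub> y)" using c closed iff by simp
    then have "mult_rel M G c y x (x \<otimes>\<^bsub>?P\<^esub> y)" 
      using bspec[OF bspec[OF bspec[OF ax4]]] c closed unfolding carrier_points by blast
    then show ?thesis using c closed iff by simp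
  qed
  obtain u where u: "u \<in> carrier ?P"
    "\<forall>x\<in>carrier ?P. mult_rel M G c u x x \<and> (\<exists>y\<in>carrier ?P. mult_rel M G c y x u)"
    using ax3 unfolding carrier_points by blast
  have ul: "u \<otimes>\<^bsub>?P\<^esub> x = x" and inv: "\<exists>y\<in>carrier ?P. y \<otimes>\<^bsub>?P\<^esub> x = u" if "x \<in> carrier ?P" for x
    using bspec[OF u(2) that] that iff u(1) by blast+
  have one: "\<one>\<^bsub>?P\<^esub> = u"
    unfolding one_points carrier_points[symmetric]
  proof (rule the_equality)
    show "u \<in> carrier ?P \<and> (\<forall>x\<in>carrier ?P. u \<otimes>\<^bsub>?P\<^esub> x = x \<and> x \<otimes>\<^bsub>?P\<^esub> u = x)"
      using u(1) ul comm by simp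
    fix u' assume "u' \<in> carrier ?P \<and> (\<forall>x\<in>carrier ?P. u' \<otimes>\<^bsub>?P\<^esub> x = x \<and> x \<otimes>\<^bsub>?P\<^esub> u' = x)"
    then show "u' = u" using u(1) ul by metis
  qed
  show "comm_group ?P"
    by (rule comm_groupI) (use closed assoc comm u(1) ul inv one in simp_all)
qed

lemma univ_eq: "univ M G c = {x \<in> tuples M (dim G). holds M (univ_fm G) (x @ c)}"
  by (simp add: univ_def solutions_def)

definition comm_group_block_fm :: "('f, 'r) dgroup \<Rightarrow> ('f, 'r) block_fm" where
  "comm_group_block_fm G =
     (let ex = (\<lambda>i b. BEx i (BAnd (BAtom (univ_fm G) [i]) b));
          all = (\<lambda>i b. BAll i (BImp (BAtom (univ_fm G) [i]) b));
          R = (\<lambda>i j k. BAtom (mult_fm G) [i, j, k]) in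
      BAnd (all 0 (all 1 (ex 2 (BAnd (R 0 1 2)
             (all 3 (BImp (R 0 1 3) (BAtom (same_tuple (dim G)) [2, 3])))))))
     (BAnd (all 0 (all 1 (all 2
             (ex 3 (BAnd (R 0 1 3) (ex 4 (BAnd (R 1 2 4) (ex 5 (BAnd (R 3 2 5) (R 0 4 5))))))))))
     (BAnd (ex 0 (all 1 (BAnd (R 0 1 1) (ex 2 (R 2 1 0)))))
           (all 0 (all 1 (all 2 (BImp (R 0 1 2) (R 1 0 2))))))))"

lemma block_sat_comm_group_block_fm:
  assumes "is_structure L M"
  shows "block_sat M c (dim G) X (comm_group_block_fm G) \<longleftrightarrow> comm_group_relation (univ M G c) (mult_rel M G c)"
proof -
  have eq: "holds M (same_tuple (dim G)) (x @ y @ c) \<longleftrightarrow> x = y"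
    if "x \<in> tuples M (dim G)" "y \<in> tuples M (dim G)" for x y
    using holds_same_tuple[OF assms] that by (simp add: tuples_def)
  have all: "(\<forall>x\<in>univ M G c. P x) \<longleftrightarrow> (\<forall>x\<in>tuples M (dim G). holds M (univ_fm G) (x @ c) \<longrightarrow> P x)"
    and ex: "(\<exists>x\<in>univ M G c. P x) \<longleftrightarrow> (\<exists>x\<in>tuples M (dim G). holds M (univ_fm G) (x @ c) \<and> P x)" for P
    by (auto simp: univ_eq)
  show ?thesis
    unfolding comm_group_block_fm_def comm_group_relation_def all ex Let_def
    by (simp add: eq)
qed

lemma comm_group_block_fm_wf:
  assumes "definable_group L M G c"
  shows "block_wf L (length c) (dim G) (comm_group_block_fm G)" "block_fv (comm_group_block_fm G) = {}"
proof -
  have "fv_fm (univ_fm G) \<subseteq> {..<length [i] * dim G + length c}" "wf_fm L (univ_fm G)"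
    "fv_fm (mult_fm G) \<subseteq> {..<length [i, j, k] * dim G + length c}" "wf_fm L (mult_fm G)"
    "fv_fm (same_tuple (dim G)) \<subseteq> {..<length [i, j] * dim G + length c}" for i j k :: nat
    using assms fv_same_tuple[of "dim G" "length c"] by (auto simp: definable_group_def forms_def)
  then show "block_wf L (length c) (dim G) (comm_group_block_fm G)"
    unfolding comm_group_block_fm_def Let_def block_wf.simps
    by (simp only: wf_same_tuple simp_thms)
  show "block_fv (comm_group_block_fm G) = {}" by (auto simp: comm_group_block_fm_def Let_def)
qed

lemma comm_group_relation_transfer:
  assumes "is_structure L M" "definable_group L M G c" "comm_group (points M G c)" "model_over L M c N d"
  shows "comm_group_relation (univ N G d) (mult_rel N G d)"
proof -
  note N = model_over_is_structure[OF assms(4)]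
  obtain x y where x: "x \<in> tuples M (dim G)" and y: "y \<in> tuples N (dim G)"
    using tuples_nonempty assms(1) N by metis
  have "block_sat M c (dim G) (\<lambda>_. x) (comm_group_block_fm G) = block_sat N d (dim G) (\<lambda>_. y) (comm_group_block_fm G)"
    using x y by (intro closed_block_fm_transfer[OF assms(1,4) comm_group_block_fm_wf[OF assms(2)]])
  then show ?thesis
    using comm_group_relation_points[OF assms(2,3)]
    unfolding block_sat_comm_group_block_fm[OF assms(1)] block_sat_comm_group_block_fm[OF N] by simp
qed

section \<open>Saturation for block formulas\<close>

lemma monster_imp_aleph0_saturated:
  assumes "monster L (U :: ('f, 'r, 'a) struct)"
  shows "aleph0_saturated L U"
proof -
  have "inj (\<lambda>i. Eq (Var i) (Var i) :: ('f, 'r) fm)" by (simp add: inj_def)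
  from infinite_super[OF subset_UNIV range_inj_infinite[OF this]]
  have inf: "infinite (UNIV :: ('f, 'r) fm set)" .
  have "small L A" if "finite A" for A :: "'a set"
    unfolding small_def by (rule finite_lepoll_infinite[OF inf that])
  then show ?thesis using assms unfolding aleph0_saturated_def monster_def by simp
qed

lemma env_prefix:
  assumes "\<And>i. length (X i) = w"
  shows "map (env c w X) [0..<length c + k * w] = c @ concat (map X [0..<k])"
proof (induction k)
  case 0
  then show ?case by (simp add: env_params)
next
  case (Suc k)
  have "[0..<length c + Suc k * w] = [0..<length c + k * w] @ block (length c) w k"
    unfolding block_def by (subst upt_add_eq_append[symmetric]) (auto simp: algebra_simps)
  then show ?case using Suc assms by (simp add: env_block)
qed

text \<open>Saturation, stated for a sequence of block formulas in the one unknown block \<open>X k\<close>, with the parameters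
  \<open>d\<close> and the blocks \<open>X 0, \<dots>, X (k - 1)\<close>.  Since \<^const>\<open>forms\<close> puts the unknown variables in front of the
  parameters, the flattened formulas are instantiated at the cyclically shifted list \<open>vs\<close> of variables.\<close>

lemma saturated_block:
  assumes sat: "aleph0_saturated L U" and U: "is_structure L U" and d: "set d \<subseteq> dom U"
    and X: "\<And>i. X i \<in> tuples U w"
    and B: "\<And>j::nat. block_wf L (length d) w (B j)" "\<And>j. block_fv (B j) \<subseteq> {..k}"
    and finsat: "\<And>J. \<exists>x\<in>tuples U w. \<forall>j\<le>J. block_sat U d w (X(k := x)) (B j)"
  shows "\<exists>x\<in>tuples U w. \<forall>j. block_sat U d w (X(k := x)) (B j)"
proof -
  define ps where "ps = d @ concat (map X [0..<k])"
  have len: "length (X i) = w" and XU: "set (X i) \<subseteq> dom U" for i using X by (auto simp: tuples_def)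
  have "length (concat (map X [0..<k])) = k * w" by (induction k) (auto simp: len)
  then have lps: "length ps = length d + k * w" by (simp add: ps_def)
  have psU: "set ps \<subseteq> dom U" using d XU by (auto simp: ps_def)
  define vs where "vs = [w..<w + length ps] @ [0..<w]"
  have lvs: "length vs = length d + Suc k * w" by (simp add: vs_def lps)
  define \<psi> where "\<psi> j = inst (flatten (length d) w (B j)) vs" for j
  have fv: "fv_fm (flatten (length d) w (B j)) \<subseteq> {..<length vs}" for j
  proof -
    have "set (block (length d) w i) \<subseteq> {..<length vs}" if "i \<le> k" for i
    proof -
      have "i * w \<le> k * w" using that by (rule mult_le_mono1)
      then have "v < length vs" if "v < length d + i * w + w" for v
        using that unfolding lvs mult_Suc by linarith
      then show ?thesis unfolding block_def by auto
    qed
    then show ?thesis using fv_flatten[OF B(1), of j] B(2)[of j] lvs by fastforce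
  qed
  have forms: "(\<psi> j, ps) \<in> forms L (set ps) w" for j
  proof -
    have "set vs \<subseteq> {..<w + length ps}" by (auto simp: vs_def)
    then show ?thesis
      using fv_inst[OF fv, of j] wf_flatten[OF B(1), of j] by (auto simp: forms_def \<psi>_def wf_inst)
  qed
  have sol: "xs \<in> solutions U w (\<psi> j, ps) \<longleftrightarrow> block_sat U d w (X(k := xs)) (B j)"
    if xs: "xs \<in> tuples U w" for xs j
  proof -
    have lx: "length xs = w" using xs by (simp add: tuples_def)
    have m: "map ((!) (xs @ ps)) vs = ps @ xs"
      using lx by (simp add: vs_def map_nth_upt del: map_append) (simp add: map_nth_upt)
    have "map (env d w (X(k := xs))) [0..<length d + Suc k * w] = d @ concat (map (X(k := xs)) [0..<Suc k])"
      using len lx by (intro env_prefix) auto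
    also have "\<dots> = ps @ xs" by (simp add: ps_def)
    finally have e: "map (env d w (X(k := xs))) [0..<length vs] = ps @ xs" by (simp only: lvs)
    have e': "(ps @ xs) ! v = env d w (X(k := xs)) v" if "v < length vs" for v
      using arg_cong[OF e, of "\<lambda>l. l ! v"] that by simp
    have "holds U (\<psi> j) (xs @ ps) = holds U (flatten (length d) w (B j)) (ps @ xs)"
      unfolding \<psi>_def holds_inst[OF fv] m ..
    also have "\<dots> = sat U (env d w (X(k := xs))) (flatten (length d) w (B j))"
      unfolding holds_def using fv[of j] e' by (intro sat_cong) auto
    also have "\<dots> = block_sat U d w (X(k := xs)) (B j)"
      using X xs by (intro sat_flatten[OF U B(1)]) auto
    finally show ?thesis using xs by (simp add: solutions_def)
  qed
  have "realizes_types_over L U (set ps)" using sat psU by (auto simp: aleph0_saturated_def)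
  moreover have "range (\<lambda>j. (\<psi> j, ps)) \<subseteq> forms L (set ps) w" using forms by auto
  moreover have "realizations U w q \<noteq> {}" if q: "q \<subseteq> range (\<lambda>j. (\<psi> j, ps))" "finite q" for q
  proof -
    obtain I where I: "finite I" "q = (\<lambda>j. (\<psi> j, ps)) ` I" using finite_subset_image[OF q(2,1)] by blast
    obtain J where J: "\<forall>j\<in>I. j \<le> J" using I(1) by (auto simp: finite_nat_set_iff_bounded_le)
    obtain x where "x \<in> tuples U w" "\<forall>j\<le>J. block_sat U d w (X(k := x)) (B j)" using finsat by blast
    then have "x \<in> realizations U w q" using I J sol by (auto simp: realizations_def)
    then show ?thesis by blast
  qed
  ultimately have "realizations U w (range (\<lambda>j. (\<psi> j, ps))) \<noteq> {}"
    unfolding realizes_types_over_def by blast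
  then show ?thesis using sol by (auto simp: realizations_def)
qed

section \<open>The order property from arbitrarily long finite chains\<close>

text \<open>A block \<open>X i\<close> of length \<open>dim G + m\<close> holds both the element \<open>a i\<close> of the group and the \<open>m\<close>-tuple \<open>b i\<close> of an
  instance of the order property.\<close>

definition chain :: "('f, 'r, 'a) struct \<Rightarrow> ('f, 'r) dgroup \<Rightarrow> 'a list \<Rightarrow> ('f, 'r) fm \<Rightarrow> nat \<Rightarrow> (nat \<Rightarrow> 'a list) \<Rightarrow> bool" where
  "chain M G c \<phi> K X \<longleftrightarrow>
     (\<forall>i<K. take (dim G) (X i) \<in> univ M G c) \<and>
     (\<forall>i<K. \<forall>j<K. holds M \<phi> (take (dim G) (X i) @ drop (dim G) (X j)) \<longleftrightarrow> i < j)"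

lemma chain_cong:
  assumes "\<forall>i<K. X i = Y i"
  shows "chain M G c \<phi> K X = chain M G c \<phi> K Y"
proof -
  have e: "i < K \<Longrightarrow> X i = Y i" for i using assms by blast
  show ?thesis unfolding chain_def
    by (intro conj_cong all_cong) (simp_all only: e)
qed

lemma chain_mono:
  assumes "chain M G c \<phi> K X" "J \<le> K"
  shows "chain M G c \<phi> J X"
proof -
  have "i < K" if "i < J" for i using that assms(2) by simp
  then show ?thesis using assms(1) unfolding chain_def by simp
qed

definition point_fm :: "('f, 'r) dgroup \<Rightarrow> nat \<Rightarrow> nat \<Rightarrow> ('f, 'r) fm" where
  "point_fm G m l = inst (univ_fm G) ([0..<dim G] @ [dim G + m..<dim G + m + l])"

definition cross_fm :: "nat \<Rightarrow> nat \<Rightarrow> ('f, 'r) fm \<Rightarrow> ('f, 'r) fm" where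
  "cross_fm n m \<phi> = inst \<phi> ([0..<n] @ [n + m + n..<n + m + (n + m)])"

definition chain_block_fm :: "('f, 'r) dgroup \<Rightarrow> nat \<Rightarrow> nat \<Rightarrow> ('f, 'r) fm \<Rightarrow> nat \<Rightarrow> ('f, 'r) block_fm" where
  "chain_block_fm G m l \<phi> K = foldr BAnd
     (map (\<lambda>i. BAtom (point_fm G m l) [i]) [0..<K] @
      map (\<lambda>(i, j). if i < j then BAtom (cross_fm (dim G) m \<phi>) [i, j]
                     else BNeg (BAtom (cross_fm (dim G) m \<phi>) [i, j]))
        (List.product [0..<K] [0..<K])) BTrue"

lemma block_sat_foldr_BAnd: "block_sat M c w X (foldr BAnd bs BTrue) \<longleftrightarrow> (\<forall>b\<in>set bs. block_sat M c w X b)"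
  by (induction bs) simp_all

lemma block_wf_foldr_BAnd: "block_wf L l w (foldr BAnd bs BTrue) \<longleftrightarrow> (\<forall>b\<in>set bs. block_wf L l w b)"
  by (induction bs) simp_all

lemma block_fv_foldr_BAnd: "block_fv (foldr BAnd bs BTrue) = (\<Union>b\<in>set bs. block_fv b)"
  by (induction bs) simp_all

lemmas foldr_BAnd = block_sat_foldr_BAnd block_wf_foldr_BAnd block_fv_foldr_BAnd

lemma block_wf_foldr_BEx: "block_wf L l w (foldr BEx ks b) = block_wf L l w b"
  by (induction ks) simp_all

lemma block_fv_foldr_BEx: "block_fv (foldr BEx ks b) = block_fv b - set ks"
  by (induction ks) auto

lemmas foldr_BEx = block_wf_foldr_BEx block_fv_foldr_BEx

lemma block_sat_foldr_BEx:
  assumes "\<And>i. X i \<in> tuples M w"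
  shows "block_sat M c w X (foldr BEx is b) \<longleftrightarrow>
    (\<exists>Y. (\<forall>i. Y i \<in> tuples M w) \<and> (\<forall>i. i \<notin> set is \<longrightarrow> Y i = X i) \<and> block_sat M c w Y b)"
  using assms
proof (induction "is" arbitrary: X)
  case Nil
  then show ?case by (auto simp: fun_eq_iff[symmetric])
next
  case (Cons k "is")
  have "block_sat M c w X (foldr BEx (k # is) b) \<longleftrightarrow> (\<exists>x\<in>tuples M w. \<exists>Y. (\<forall>i. Y i \<in> tuples M w) \<and>
      (\<forall>i. i \<notin> set is \<longrightarrow> Y i = (X(k := x)) i) \<and> block_sat M c w Y b)"
    unfolding foldr.simps comp_apply block_sat.simps
    by (rule bex_cong[OF refl], rule Cons.IH) (simp add: Cons.prems)
  also have "\<dots> \<longleftrightarrow> (\<exists>Y. (\<forall>i. Y i \<in> tuples M w) \<and> (\<forall>i. i \<notin> set (k # is) \<longrightarrow> Y i = X i) \<and> block_sat M c w Y b)"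
    (is "?L \<longleftrightarrow> ?R")
  proof
    assume ?L
    then show ?R by (auto split: if_splits)
  next
    assume ?R
    then obtain Y where Y: "\<forall>i. Y i \<in> tuples M w" "\<forall>i. i \<notin> set (k # is) \<longrightarrow> Y i = X i" "block_sat M c w Y b" by blast
    then show ?L by (intro bexI[of _ "Y k"] exI[of _ Y]) auto
  qed
  finally show ?case .
qed

locale order_chains =
  fixes L :: "('f, 'r) lang" and G :: "('f, 'r) dgroup" and l m :: nat and \<phi> :: "('f, 'r) fm"
  assumes univ_wf: "wf_fm L (univ_fm G)" "fv_fm (univ_fm G) \<subseteq> {..<dim G + l}"
    and \<phi>_wf: "wf_fm L \<phi>" "fv_fm \<phi> \<subseteq> {..<dim G + m}"
begin

abbreviation "w \<equiv> dim G + m"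

lemma chain_block_fm_wf:
  "block_wf L l w (chain_block_fm G m l \<phi> K)" "block_fv (chain_block_fm G m l \<phi> K) \<subseteq> {..<K}"
proof -
  have "wf_fm L (point_fm G m l)" "wf_fm L (cross_fm (dim G) m \<phi>)"
    using univ_wf \<phi>_wf by (simp_all add: point_fm_def cross_fm_def wf_inst)
  moreover have "fv_fm (point_fm G m l) \<subseteq> {..<w + l}"
    unfolding point_fm_def using univ_wf by (intro order_trans[OF fv_inst]) auto
  moreover have "fv_fm (cross_fm (dim G) m \<phi>) \<subseteq> {..<w + w + l}"
    unfolding cross_fm_def using \<phi>_wf by (intro order_trans[OF fv_inst]) auto
  ultimately show "block_wf L l w (chain_block_fm G m l \<phi> K)"
    by (auto simp: chain_block_fm_def foldr_BAnd simp del: foldr_append foldr_map)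
  show "block_fv (chain_block_fm G m l \<phi> K) \<subseteq> {..<K}"
    by (auto simp: chain_block_fm_def foldr_BAnd simp del: foldr_append foldr_map split: if_splits)
qed

lemma block_sat_chain_block_fm:
  assumes X: "\<And>i. X i \<in> tuples M w" and c: "length c = l"
  shows "block_sat M c w X (chain_block_fm G m l \<phi> K) \<longleftrightarrow> chain M G c \<phi> K X"
proof -
  have lX: "length (X i) = w" for i using X by (simp add: tuples_def)
  have 1: "holds M (point_fm G m l) (X i @ c) \<longleftrightarrow> take (dim G) (X i) \<in> univ M G c" for i
  proof -
    have "holds M (point_fm G m l) (X i @ c) \<longleftrightarrow> holds M (univ_fm G) (take (dim G) (X i) @ c)"
      unfolding point_fm_def using univ_wf c lX by (subst holds_inst) (auto simp: map_nth_upt)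
    moreover have "take (dim G) (X i) \<in> tuples M (dim G)"
      using X[of i] by (auto simp: tuples_def dest: in_set_takeD)
    ultimately show ?thesis by (simp add: univ_eq)
  qed
  have 2: "holds M (cross_fm (dim G) m \<phi>) (X i @ X j @ c) \<longleftrightarrow>
      holds M \<phi> (take (dim G) (X i) @ drop (dim G) (X j))" for i j
    unfolding cross_fm_def using \<phi>_wf lX by (subst holds_inst) (auto simp: map_nth_upt)
  have less: "(\<forall>i<K. P i) \<longleftrightarrow> (\<forall>i\<in>{0..<K}. P i)" for P by auto
  have 3: "(a \<longrightarrow> b) \<and> (\<not> a \<longrightarrow> \<not> b) \<longleftrightarrow> (b \<longleftrightarrow> a)" for a b by auto
  show ?thesis
    unfolding chain_block_fm_def foldr_BAnd chain_def
    by (simp add: 1 2 3 ball_Un less)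
qed

text \<open>Expresses that the blocks below \<open>k\<close> begin a chain of length \<open>K\<close>.\<close>

definition extension_block_fm :: "nat \<Rightarrow> nat \<Rightarrow> ('f, 'r) block_fm" where
  "extension_block_fm k K = foldr BEx [k..<K] (chain_block_fm G m l \<phi> K)"

lemma extension_block_fm_wf:
  "block_wf L l w (extension_block_fm k K)" "block_fv (extension_block_fm k K) \<subseteq> {..<k}"
proof -
  show "block_wf L l w (extension_block_fm k K)"
    unfolding extension_block_fm_def foldr_BEx by (rule chain_block_fm_wf)
  have "{..<K} - set [k..<K] \<subseteq> {..<k}" by auto
  with chain_block_fm_wf(2)[of K] show "block_fv (extension_block_fm k K) \<subseteq> {..<k}"
    unfolding extension_block_fm_def foldr_BEx by blast
qed

lemma block_sat_extension_block_fm: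
  assumes X: "\<And>i. X i \<in> tuples M w" and c: "length c = l"
  shows "block_sat M c w X (extension_block_fm k K) \<longleftrightarrow>
    (\<exists>Y. (\<forall>i. Y i \<in> tuples M w) \<and> (\<forall>i<k. Y i = X i) \<and> chain M G c \<phi> K Y)"
  unfolding extension_block_fm_def block_sat_foldr_BEx[of X, OF X]
proof
  assume "\<exists>Y. (\<forall>i. Y i \<in> tuples M w) \<and> (\<forall>i. i \<notin> set [k..<K] \<longrightarrow> Y i = X i) \<and>
    block_sat M c w Y (chain_block_fm G m l \<phi> K)"
  then obtain Y where Y: "\<forall>i. Y i \<in> tuples M w" "\<forall>i. i \<notin> set [k..<K] \<longrightarrow> Y i = X i"
    "block_sat M c w Y (chain_block_fm G m l \<phi> K)" by blast
  have "chain M G c \<phi> K Y" using block_sat_chain_block_fm[of Y M c K] Y(1,3) c by simp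
  then show "\<exists>Y. (\<forall>i. Y i \<in> tuples M w) \<and> (\<forall>i<k. Y i = X i) \<and> chain M G c \<phi> K Y"
    using Y(1,2) by (intro exI[of _ Y]) simp
next
  assume "\<exists>Y. (\<forall>i. Y i \<in> tuples M w) \<and> (\<forall>i<k. Y i = X i) \<and> chain M G c \<phi> K Y"
  then obtain Y where Y: "\<forall>i. Y i \<in> tuples M w" "\<forall>i<k. Y i = X i" "chain M G c \<phi> K Y" by blast
  define Z where "Z i = (if i < K then Y i else X i)" for i
  have "chain M G c \<phi> K Z" using Y(3) chain_cong[of K Z Y M G c \<phi>] by (simp add: Z_def)
  moreover have Z: "Z i \<in> tuples M w" for i using X Y by (simp add: Z_def)
  moreover have "Z i = X i" if "i \<notin> set [k..<K]" for i using Y(2) that by (auto simp: Z_def)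
  ultimately show "\<exists>Y. (\<forall>i. Y i \<in> tuples M w) \<and> (\<forall>i. i \<notin> set [k..<K] \<longrightarrow> Y i = X i) \<and>
    block_sat M c w Y (chain_block_fm G m l \<phi> K)"
    using block_sat_chain_block_fm[of Z M c K, OF Z c] by (intro exI[of _ Z]) auto
qed

lemma chain_transfer:
  assumes M: "is_structure L M" and MN: "model_over L M c N d" and MU: "model_over L M c U e"
    and c: "length c = l" and X: "\<And>i. X i \<in> tuples N w" and chain: "chain N G d \<phi> K X"
  shows "\<exists>Y. (\<forall>i. Y i \<in> tuples U w) \<and> chain U G e \<phi> K Y"
proof -
  obtain x where x: "x \<in> tuples M w" using tuples_nonempty[OF M] by blast
  obtain y where y: "y \<in> tuples U w" using tuples_nonempty[OF model_over_is_structure[OF MU]] by blast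
  have len: "length d = l" "length e = l" using MN MU c by (auto simp: model_over_def tuples_def)
  have wf: "block_wf L (length c) w (extension_block_fm 0 K)" unfolding c by (rule extension_block_fm_wf)
  have closed: "block_fv (extension_block_fm 0 K) = {}" using extension_block_fm_wf(2)[of 0 K] by simp
  have "block_sat N d w X (extension_block_fm 0 K)"
    using X chain by (subst block_sat_extension_block_fm[OF X len(1)]) auto
  then have "block_sat M c w (\<lambda>_. x) (extension_block_fm 0 K)"
    using closed_block_fm_transfer[OF M MN wf closed, of "\<lambda>_. x" X] x X by simp
  then have "block_sat U e w (\<lambda>_. y) (extension_block_fm 0 K)"
    using closed_block_fm_transfer[OF M MU wf closed, of "\<lambda>_. x" "\<lambda>_. y"] x y by simp
  then show ?thesis using block_sat_extension_block_fm[of "\<lambda>_. y" U e 0 K] y len by auto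
qed

text \<open>The limit of longer and longer chains is built block by block.  An initial segment is kept extendible:
  it is the beginning of a chain of each finite length.  The requirements on the next block are that the
  longer segment again begins a chain of length \<open>K\<close>, for each \<open>K\<close>; finitely many of them are satisfied by
  the next block of one sufficiently long chain, so saturation over the finitely many previous blocks
  satisfies them all.\<close>

lemma order_property_if_chains:
  assumes sat: "aleph0_saturated L U" and U: "is_structure L U" and d: "d \<in> tuples U l"
    and chains: "\<And>K. \<exists>Y. (\<forall>i. Y i \<in> tuples U w) \<and> chain U G d \<phi> K Y"
  shows "order_property U (univ U G d) m \<phi>"
proof -
  have ld: "length d = l" and dU: "set d \<subseteq> dom U" using d by (auto simp: tuples_def)
  define extendible where "extendible k X \<longleftrightarrow> (\<forall>i. X i \<in> tuples U w) \<and>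
    (\<forall>K. \<exists>Y. (\<forall>i. Y i \<in> tuples U w) \<and> (\<forall>i<k. Y i = X i) \<and> chain U G d \<phi> K Y)" for k X
  have "\<exists>f. \<forall>k. extendible k (f k) \<and> (\<forall>i<k. f (Suc k) i = f k i)"
  proof (rule dependent_nat_choice)
    obtain y where "y \<in> tuples U w" using tuples_nonempty[OF U] by blast
    then show "\<exists>X. extendible 0 X" using chains by (intro exI[of _ "\<lambda>_. y"]) (simp add: extendible_def)
  next
    fix X k assume ext: "extendible k X"
    then have X: "\<And>i. X i \<in> tuples U w" by (simp add: extendible_def)
    have "\<exists>x\<in>tuples U w. \<forall>j. block_sat U d w (X(k := x)) (extension_block_fm (Suc k) j)"
    proof (rule saturated_block[OF sat U dU X])
      show "block_wf L (length d) w (extension_block_fm (Suc k) j)" for j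
        unfolding ld by (rule extension_block_fm_wf)
      show "block_fv (extension_block_fm (Suc k) j) \<subseteq> {..k}" for j
        using extension_block_fm_wf(2)[of "Suc k" j] by (simp add: lessThan_Suc_atMost)
      fix J
      obtain Y where Y: "\<forall>i. Y i \<in> tuples U w" "\<forall>i<k. Y i = X i" "chain U G d \<phi> J Y"
        using ext unfolding extendible_def by blast
      have "block_sat U d w (X(k := Y k)) (extension_block_fm (Suc k) j)" if "j \<le> J" for j
        using X Y chain_mono[OF Y(3) that]
        by (subst block_sat_extension_block_fm) (auto simp: ld less_Suc_eq intro!: exI[of _ Y])
      then show "\<exists>x\<in>tuples U w. \<forall>j\<le>J. block_sat U d w (X(k := x)) (extension_block_fm (Suc k) j)"
        using Y(1) by blast
    qed
    then obtain x where x: "x \<in> tuples U w" "\<forall>j. block_sat U d w (X(k := x)) (extension_block_fm (Suc k) j)" by blast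
    have valid: "\<And>i. (X(k := x)) i \<in> tuples U w" using X x by simp
    have "\<exists>Y. (\<forall>i. Y i \<in> tuples U w) \<and> (\<forall>i<Suc k. Y i = (X(k := x)) i) \<and> chain U G d \<phi> K Y" for K
      using x(2) by (subst block_sat_extension_block_fm[OF valid ld, symmetric]) (rule spec)
    then have "extendible (Suc k) (X(k := x))" using valid by (simp only: extendible_def) simp
    then show "\<exists>Y. extendible (Suc k) Y \<and> (\<forall>i<k. Y i = X i)" by (intro exI[of _ "X(k := x)"]) simp
  qed
  then obtain f where "\<forall>k. extendible k (f k) \<and> (\<forall>i<k. f (Suc k) i = f k i)" ..
  then have f: "\<And>k. extendible k (f k)" "\<And>k i. i < k \<Longrightarrow> f (Suc k) i = f k i" by simp_all
  define Z where "Z i = f (Suc i) i" for i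
  have fZ: "f k i = Z i" if "i < k" for k i
    using that by (induction k) (auto simp: Z_def f(2) less_Suc_eq)
  have Z: "Z i \<in> tuples U w" for i using f(1) by (auto simp: Z_def extendible_def)
  have cZ: "chain U G d \<phi> K Z" for K
  proof -
    obtain Y where "\<forall>i<K. Y i = f K i" "chain U G d \<phi> K Y"
      using f(1)[of K] unfolding extendible_def by blast
    then show ?thesis using chain_cong[of K Y Z U G d \<phi>] fZ by simp
  qed
  show ?thesis unfolding order_property_def
  proof (intro exI conjI allI)
    fix i j
    have "chain U G d \<phi> (Suc (max i j)) Z" by (rule cZ)
    then show "take (dim G) (Z i) \<in> univ U G d"
      and "holds U \<phi> (take (dim G) (Z i) @ drop (dim G) (Z j)) \<longleftrightarrow> i < j"
      unfolding chain_def by (auto simp: less_Suc_eq_le)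
    show "drop (dim G) (Z i) \<in> tuples U m" using Z[of i] by (auto simp: tuples_def dest: in_set_dropD)
  qed
qed

end

section \<open>The J-property\<close>

text \<open>The formula \<open>x \<cdot> y \<notin> X\<close> for the set \<open>X\<close> defined by \<open>\<theta>(z, b)\<close>, in the variables \<open>x, y, b, c\<close>; the last three
  together form the second argument of an instance of the order property.  The negation turns the
  pattern \<open>a i \<cdot> g j \<in> X \<longleftrightarrow> j \<le> i\<close> into \<open>i < j\<close>.\<close>

definition outside_fm :: "('f, 'r) dgroup \<Rightarrow> ('f, 'r) fm \<Rightarrow> nat \<Rightarrow> nat \<Rightarrow> ('f, 'r) fm" where
  "outside_fm G \<theta> q l =
     (let n = dim G; s = n + n + q + l; z = [s..<s + n]; c = [n + n + q..<s] in
      Neg (exs s n (And (inst (univ_fm G) (z @ c))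
        (And (inst (mult_fm G) ([0..<n + n] @ z @ c)) (inst \<theta> (z @ [n + n..<n + n + q]))))))"

context
  fixes L :: "('f, 'r) lang" and G :: "('f, 'r) dgroup" and \<theta> :: "('f, 'r) fm" and q l :: nat
  assumes wf: "wf_fm L (univ_fm G)" "wf_fm L (mult_fm G)" "wf_fm L \<theta>"
    and fv: "fv_fm (univ_fm G) \<subseteq> {..<dim G + l}" "fv_fm (mult_fm G) \<subseteq> {..<3 * dim G + l}"
      "fv_fm \<theta> \<subseteq> {..<dim G + q}"
begin

lemma outside_fm_wf:
  "wf_fm L (outside_fm G \<theta> q l)" "fv_fm (outside_fm G \<theta> q l) \<subseteq> {..<dim G + (dim G + q + l)}"
proof -
  show "wf_fm L (outside_fm G \<theta> q l)"
    using wf by (simp add: outside_fm_def Let_def wf_exs wf_inst)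
  define n where "n = dim G"
  define s where "s = n + n + q + l"
  have "fv_fm (inst (univ_fm G) ([s..<s + n] @ [n + n + q..<s])) \<subseteq> {..<s + n}"
    using fv(1) by (intro order_trans[OF fv_inst]) (auto simp: n_def s_def)
  moreover have "fv_fm (inst (mult_fm G) ([0..<n + n] @ [s..<s + n] @ [n + n + q..<s])) \<subseteq> {..<s + n}"
    using fv(2) by (intro order_trans[OF fv_inst]) (auto simp: n_def s_def)
  moreover have "fv_fm (inst \<theta> ([s..<s + n] @ [n + n..<n + n + q])) \<subseteq> {..<s + n}"
    using fv(3) by (intro order_trans[OF fv_inst]) (auto simp: n_def s_def)
  ultimately have "fv_fm (outside_fm G \<theta> q l) \<subseteq> {..<s + n} - {s..<s + n}"
    unfolding outside_fm_def Let_def n_def[symmetric] s_def[symmetric] fv_fm.simps fv_exs by blast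
  also have "\<dots> \<subseteq> {..<dim G + (dim G + q + l)}" by (auto simp: s_def n_def)
  finally show "fv_fm (outside_fm G \<theta> q l) \<subseteq> {..<dim G + (dim G + q + l)}" .
qed

lemma holds_outside_fm:
  assumes x: "length x = dim G" and y: "length y = dim G" and b: "length b = q" and c: "length c = l"
  shows "holds M (outside_fm G \<theta> q l) (x @ y @ b @ c) \<longleftrightarrow>
    \<not> (\<exists>z\<in>univ M G c. mult_rel M G c x y z \<and> z \<in> solutions M (dim G) (\<theta>, b))"
proof -
  define n where "n = dim G"
  define s where "s = n + n + q + l"
  let ?u = "inst (univ_fm G) ([s..<s + n] @ [n + n + q..<s])"
  let ?m = "inst (mult_fm G) ([0..<n + n] @ [s..<s + n] @ [n + n + q..<s])"
  let ?t = "inst \<theta> ([s..<s + n] @ [n + n..<n + n + q])"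
  have parts: "holds M ?u (x @ y @ b @ c @ z) = holds M (univ_fm G) (z @ c)"
    "holds M ?m (x @ y @ b @ c @ z) = holds M (mult_fm G) (x @ y @ z @ c)"
    "holds M ?t (x @ y @ b @ c @ z) = holds M \<theta> (z @ b)" if "length z = n" for z
    using that fv x y b c unfolding n_def s_def
    by (subst holds_inst; auto simp: map_nth_upt n_def s_def)+
  have fvb: "fv_fm (And ?u (And ?m ?t)) \<subseteq> {..<s + n}"
  proof -
    have "fv_fm ?u \<subseteq> {..<s + n}"
      using fv(1) by (intro order_trans[OF fv_inst]) (auto simp: n_def s_def)
    moreover have "fv_fm ?m \<subseteq> {..<s + n}"
      using fv(2) by (intro order_trans[OF fv_inst]) (auto simp: n_def s_def)
    moreover have "fv_fm ?t \<subseteq> {..<s + n}"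
      using fv(3) by (intro order_trans[OF fv_inst]) (auto simp: n_def s_def)
    ultimately show ?thesis by simp
  qed
  have len: "length (x @ y @ b @ c) = s" using x y b c by (simp add: s_def n_def)
  have "holds M (outside_fm G \<theta> q l) (x @ y @ b @ c) \<longleftrightarrow> \<not> holds M (exs s n (And ?u (And ?m ?t))) (x @ y @ b @ c)"
    by (simp add: outside_fm_def Let_def holds_def n_def s_def)
  also have "\<dots> \<longleftrightarrow> \<not> (\<exists>z\<in>tuples M n. holds M (univ_fm G) (z @ c) \<and>
      holds M (mult_fm G) (x @ y @ z @ c) \<and> holds M \<theta> (z @ b))"
    unfolding holds_exs[OF len fvb]
    by (intro arg_cong[where f = Not] bex_cong refl) (simp add: holds_def[of M "And _ _"] parts[unfolded holds_def[of M "inst _ _"]] tuples_def)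
  also have "\<dots> \<longleftrightarrow> \<not> (\<exists>z\<in>univ M G c. mult_rel M G c x y z \<and> z \<in> solutions M (dim G) (\<theta>, b))"
    by (auto simp: univ_eq solutions_def n_def)
  finally show ?thesis .
qed

end

theorem theorem3p1:
  fixes L :: "('f, 'r) lang" and M :: "('f, 'r, 'a) struct"
    and G :: "('f, 'r) dgroup" and c :: "'a list"
  assumes "is_structure L M"
    and "definable_group L M G c"
    and "comm_group (points M G c)"
    and "superstable TYPE('u) L M G c"
  shows "J_property TYPE('b) L M G c"
proof -
  have wfG: "wf_fm L (univ_fm G)" "wf_fm L (mult_fm G)"
    and fvG: "fv_fm (univ_fm G) \<subseteq> {..<dim G + length c}" "fv_fm (mult_fm G) \<subseteq> {..<3 * dim G + length c}"
    using assms(2) by (auto simp: definable_group_def forms_def)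
  obtain U :: "('f, 'r, 'u) struct" and e where U: "model_over L M c U e" "monster L U"
    and stable: "\<forall>m \<phi>. wf_fm L \<phi> \<and> fv_fm \<phi> \<subseteq> {..<dim G + m} \<longrightarrow>
      \<not> order_property U (univ U G e) m \<phi>"
    using assms(4) unfolding superstable_def by (elim exE conjE) (rule that)
  have e: "e \<in> tuples U (length c)" using U(1) by (simp add: model_over_def)
  have "J_set (points N G d) X \<longleftrightarrow> weakly_generic (points N G d) X"
    if N: "model_over L M c N d" and X: "X \<subseteq> univ N G d" and def: "definable L N (dim G) X"
    for N :: "('f, 'r, 'b) struct" and d X
  proof -
    let ?P = "points N G d"
    note rel = comm_group_relation_transfer[OF assms(1-3) N]
    interpret comm_group ?P by (rule comm_group_pointsI(1)[OF rel])
    interpret plain_comm_group ?P ..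
    have d: "length d = length c" "set d \<subseteq> dom N" using N by (auto simp: model_over_def tuples_def)
    have len: "length x = dim G" "set x \<subseteq> dom N" if "x \<in> univ N G d" for x
      using that by (auto simp: univ_eq tuples_def)
    from def obtain \<theta> b where \<theta>: "wf_fm L \<theta>" "fv_fm \<theta> \<subseteq> {..<dim G + length b}" "set b \<subseteq> dom N"
      and X_eq: "X = solutions N (dim G) (\<theta>, b)"
      by (auto simp: definable_def forms_def)
    define \<phi> where "\<phi> = outside_fm G \<theta> (length b) (length c)"
    define m where "m = dim G + length b + length c"
    note wf = outside_fm_wf[OF wfG \<theta>(1) fvG \<theta>(2), folded \<phi>_def m_def]
    interpret order_chains L G "length c" m \<phi>
      using wfG fvG wf by unfold_locales
    have outside: "holds N \<phi> (x @ y @ b @ d) \<longleftrightarrow> x \<otimes>\<^bsub>?P\<^esub> y \<notin> X" if xy: "x \<in> univ N G d" "y \<in> univ N G d" for x y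
    proof -
      have "x \<otimes>\<^bsub>?P\<^esub> y \<in> univ N G d" using m_closed xy by (simp add: carrier_points)
      then have "(\<exists>z\<in>univ N G d. mult_rel N G d x y z \<and> z \<in> X) \<longleftrightarrow> x \<otimes>\<^bsub>?P\<^esub> y \<in> X"
        using comm_group_pointsI(2)[OF rel xy] by blast
      then show ?thesis
        using holds_outside_fm[OF wfG \<theta>(1) fvG \<theta>(2), of x y b d N] len xy d
        unfolding \<phi>_def X_eq by simp
    qed
    have "generic ?P X" if J: "J_set ?P X"
    proof (rule ccontr)
      assume ng: "\<not> generic ?P X"
      have "\<exists>Y. (\<forall>i. Y i \<in> tuples U w) \<and> chain U G e \<phi> K Y" for K
      proof -
        obtain a g where ag: "\<forall>i. a i \<in> carrier ?P \<and> g i \<in> carrier ?P"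
          and agX: "\<forall>i<K. \<forall>j<K. a i \<otimes>\<^bsub>?P\<^esub> g j \<in> X \<longleftrightarrow> j \<le> i"
          using nongeneric_J_set_chains[OF J ng, of K] by blast
        then have au: "\<And>i. a i \<in> univ N G d" and gu: "\<And>i. g i \<in> univ N G d"
          by (simp_all add: carrier_points)
        define Z where "Z i = a i @ g i @ b @ d" for i
        have "Z i \<in> tuples N w" for i
          using len[OF au] len[OF gu] \<theta>(3) d by (simp add: Z_def tuples_def m_def)
        moreover have "chain N G d \<phi> K Z"
          unfolding chain_def Z_def using len[OF au] au gu agX
          by (auto simp: outside not_le)
        ultimately show ?thesis by (intro chain_transfer[OF assms(1) N U(1) refl])
      qed
      then have "order_property U (univ U G e) m \<phi>"
        by (intro order_property_if_chains[OF monster_imp_aleph0_saturated[OF U(2)]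
              model_over_is_structure[OF U(1)] e])
      with stable wf show False by blast
    qed
    then show ?thesis using generic_imp_weakly_generic weakly_generic_imp_J_set by blast
  qed
  then show ?thesis unfolding J_property_def by blast
qed

end
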